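(* Let $p$ be a prime and let $F=\langle a,b,c\rangle$ be the free group of rank $3$ with free basis $X=\{a,b,c\}$. Let $r_1,r_2,\dots$ be an enumeration of the elements of the derived subgroup $\gamma_2F=[F,F]$ of $F$. Let $n_1,n_2,\dots$ be a sequence of integers such that $\sum_{i}\frac{1}{p^{n_i}}\le\frac12$, and let $R=\{r_i^{p^{n_i}} : i\geq 1\}$. Then the group $G=\langle X\mid R\rangle$ (the quotient of $F$ by the normal closure of $R$) has Tarski number $\mathcal T(G)=5$.
   Context: A group $G$ admits a paradoxical decomposition if there exist positive integers $m$ and $n$, pairwise disjoint subsets $P_1,\ldots,P_m,Q_1,\ldots,Q_n$ of $G$, and subsets $S_1=\{g_1,\ldots,g_m\}$, $S_2=\{h_1,\ldots,h_n\}$ of $G$ such that $G=\bigcup_{i=1}^m g_iP_i=\bigcup_{j=1}^n h_jQ_j$. The Tarski number $\mathcal T(G)$ of a group $G$ admitting a paradoxical decomposition (equivalently, of a non-amenable group) is the minimal possible value of $m+n$ over all paradoxical decompositions of $G$. The assertion $\mathcal T(G)=5$ includes that $G$ admits a paradoxical decomposition. *)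

theory Defs
  imports Complex_Main "HOL-Algebra.Generated_Groups" "HOL-Computational_Algebra.Primes" "HOL-Library.Disjoint_Sets"
begin

text \<open>
  A word over \<open>X\<close> is a list of letters \<open>(x, e)\<close> with \<open>x \<in> X\<close>, where \<open>(x, True)\<close> stands for
  \<open>x\<close> and \<open>(x, False)\<close> for the inverse of \<open>x\<close>.
\<close>

definition letter_value :: "('a, 'b) monoid_scheme \<Rightarrow> 'a \<times> bool \<Rightarrow> 'a" where
  "letter_value F l = (if snd l then fst l else inv\<^bsub>F\<^esub> fst l)"

definition word_value :: "('a, 'b) monoid_scheme \<Rightarrow> ('a \<times> bool) list \<Rightarrow> 'a" where
  "word_value F w = foldr (\<lambda>l y. letter_value F l \<otimes>\<^bsub>F\<^esub> y) w \<one>\<^bsub>F\<^esub>"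

definition reduced_word :: "('a \<times> bool) list \<Rightarrow> bool" where
  "reduced_word w \<longleftrightarrow> successively (\<lambda>l l'. \<not> (fst l = fst l' \<and> snd l \<noteq> snd l')) w"

text \<open>
  \<open>F\<close> is free on \<open>X\<close>: \<open>X\<close> generates \<open>F\<close>, and no nonempty reduced word over \<open>X\<close> is trivial
  in \<open>F\<close>. (The universal property of free groups quantifies over groups on all types and so
  cannot be used as a definition in HOL.)
\<close>

definition free_basis :: "('a, 'b) monoid_scheme \<Rightarrow> 'a set \<Rightarrow> bool" where
  "free_basis F X \<longleftrightarrow>
     X \<subseteq> carrier F \<and> generate F X = carrier F \<and>
     (\<forall>w. fst ` set w \<subseteq> X \<and> reduced_word w \<and> w \<noteq> [] \<longrightarrow> word_value F w \<noteq> \<one>\<^bsub>F\<^esub>)"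

definition normal_closure :: "('a, 'b) monoid_scheme \<Rightarrow> 'a set \<Rightarrow> 'a set" where
  "normal_closure F R = \<Inter> {N. N \<lhd> F \<and> R \<subseteq> N}"

text \<open>
  The translating elements are given as families, so repetitions among the \<open>g i\<close> (or the
  \<open>h j\<close>) are allowed; pieces with the same translating element can be merged, so this does not
  affect the least value of \<open>m + n\<close>.
\<close>

definition paradoxical_decomposition ::
  "('a, 'b) monoid_scheme \<Rightarrow> nat \<Rightarrow> nat \<Rightarrow> (nat \<Rightarrow> 'a set) \<Rightarrow> (nat \<Rightarrow> 'a set)
     \<Rightarrow> (nat \<Rightarrow> 'a) \<Rightarrow> (nat \<Rightarrow> 'a) \<Rightarrow> bool" where
  "paradoxical_decomposition G m n P Q g h \<longleftrightarrow>
     m \<ge> 1 \<and> n \<ge> 1 \<and>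
     (\<forall>i\<in>{1..m}. P i \<subseteq> carrier G \<and> g i \<in> carrier G) \<and>
     (\<forall>j\<in>{1..n}. Q j \<subseteq> carrier G \<and> h j \<in> carrier G) \<and>
     disjoint_family_on P {1..m} \<and> disjoint_family_on Q {1..n} \<and>
     (\<forall>i\<in>{1..m}. \<forall>j\<in>{1..n}. P i \<inter> Q j = {}) \<and>
     carrier G = (\<Union>i\<in>{1..m}. g i <#\<^bsub>G\<^esub> P i) \<and>
     carrier G = (\<Union>j\<in>{1..n}. h j <#\<^bsub>G\<^esub> Q j)"

definition admits_paradoxical_decomposition :: "('a, 'b) monoid_scheme \<Rightarrow> bool" where
  "admits_paradoxical_decomposition G \<longleftrightarrow>
     (\<exists>m n P Q g h. paradoxical_decomposition G m n P Q g h)"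

text \<open>Only meaningful for groups that admit a paradoxical decomposition.\<close>

definition tarski_number :: "('a, 'b) monoid_scheme \<Rightarrow> nat" where
  "tarski_number G =
     (LEAST k. \<exists>m n P Q g h. paradoxical_decomposition G m n P Q g h \<and> k = m + n)"

end

theory Submission
  imports Defs "HOL-Algebra.Multiplicative_Group" "HOL-Number_Theory.Cong"
begin

text \<open>
  Lower bound: a decomposition into four pieces yields, by ping-pong, two elements whose commutator
  has infinite order, whereas the derived subgroup of \<open>G\<close> is torsion.

  Upper bound: let \<open>K\<close> be the intersection of all normal subgroups of finite index of \<open>F\<close> that
  contain \<open>R\<close>. It suffices to decompose \<open>F / K\<close> with the translation sets \<open>{1, a}\<close> and
  \<open>{1, b, c}\<close>, and by Hall's theorem this amounts to
  \<open>|A| + |B| \<le> |A \<union> aA \<union> B \<union> bB \<union> cB|\<close> for finite \<open>A\<close>, \<open>B\<close>. Map \<open>A\<close> and \<open>B\<close>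
  injectively to a finite quotient \<open>Q\<close> of order \<open>N\<close>, and consider functions modulo \<open>p\<close> on the
  \<open>3N\<close> edges of its Cayley graph that sum to \<open>0\<close> along every relator. A relator
  \<open>r^(p^n)\<close> imposes at most \<open>N / p^n\<close> conditions: if \<open>r\<close> has order \<open>p^n\<close> in \<open>Q\<close>, one for each
  \<open>r\<close>-cycle, and otherwise none, because the relator runs through a shorter cycle a multiple of
  \<open>p\<close> times. So this space has dimension at least \<open>5N/2\<close>, and it has a coordinate set \<open>J\<close> of that
  many edges, which can be chosen to contain nearly all \<open>a\<close>-edges since \<open>a\<close> has infinite order in
  the abelianization. The functions lift to differentials of functions on \<open>F / K\<close>, so
  \<open>J\<close> meets the edges \<open>(x, ax)\<close>, \<open>(y, by)\<close>, \<open>(y, cy)\<close> with \<open>x \<in> A\<close>, \<open>y \<in> B\<close>, and every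
  translate of this set, in at most \<open>|A \<union> aA \<union> B \<union> bB \<union> cB|\<close> edges. Averaging over the
  translates gives \<open>|A \<union> aA \<union> B \<union> bB \<union> cB| \<ge> (1 - \<epsilon>)|A| + 3/2 |B|\<close>.
\<close>

subsection \<open>Hall's theorem\<close>

text \<open>The admissible choices form a set of pairs, so that deleting one choice is a set
  difference. \<open>I\<close> may be infinite; only finite \<open>J\<close> are tested.\<close>

definition hall_condition :: "'i set \<Rightarrow> ('i \<times> 'b) set \<Rightarrow> bool" where
  "hall_condition I T \<longleftrightarrow> (\<forall>J. J \<subseteq> I \<longrightarrow> finite J \<longrightarrow> card J \<le> card (T `` J))"

text \<open>Zorn's lemma for the sets of deleted pairs. Only finitely many pairs of \<open>T\<close>
  start in a finite \<open>J\<close>, so those deleted by a whole chain are already deleted by one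
  of its members.\<close>

lemma hall_minimal_exists:
  assumes fin: "\<And>i. i \<in> I \<Longrightarrow> finite (T `` {i})" and "hall_condition I T"
  obtains M where "M \<subseteq> T" "hall_condition I M" "\<And>e. e \<in> M \<Longrightarrow> \<not> hall_condition I (M - {e})"
proof -
  define D where "D = {X. X \<subseteq> T \<and> hall_condition I (T - X)}"
  have "\<exists>X\<in>D. \<forall>Y\<in>D. X \<subseteq> Y \<longrightarrow> Y = X"
  proof (rule subset_Zorn_nonempty)
    show "D \<noteq> {}" using assms(2) by (auto simp: D_def intro: exI[of _ "{}"])
    fix C assume C: "C \<noteq> {}" "subset.chain D C"
    have CD: "C \<subseteq> D" using C(2) by (simp add: subset_chain_def)
    have "hall_condition I (T - \<Union>C)"
      unfolding hall_condition_def
    proof (intro allI impI)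
      fix J assume J: "J \<subseteq> I" "finite J"
      have "T \<inter> J \<times> UNIV = (\<Union>i\<in>J. Pair i ` (T `` {i}))" by auto
      then have "finite (T \<inter> J \<times> UNIV)" using J fin by auto
      then have "finite (\<Union>C \<inter> T \<inter> J \<times> UNIV)" by (rule rev_finite_subset) auto
      then obtain B where B: "B \<in> C" "\<Union>C \<inter> T \<inter> J \<times> UNIV \<subseteq> B"
        using finite_subset_Union_chain[OF _ _ C, of "\<Union>C \<inter> T \<inter> J \<times> UNIV"] by blast
      have "(T - \<Union>C) `` J = (T - B) `` J" using B by blast
      moreover have "hall_condition I (T - B)" using B CD by (auto simp: D_def)
      ultimately show "card J \<le> card ((T - \<Union>C) `` J)" using J by (simp add: hall_condition_def)
    qed
    then show "\<Union>C \<in> D" using CD by (auto simp: D_def)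
  qed
  then obtain X where X: "X \<in> D" "\<And>Y. Y \<in> D \<Longrightarrow> X \<subseteq> Y \<Longrightarrow> Y = X" by blast
  show thesis
  proof (rule that[of "T - X"])
    show "hall_condition I (T - X)" using X(1) by (simp add: D_def)
    fix e assume e: "e \<in> T - X"
    show "\<not> hall_condition I (T - X - {e})"
    proof
      assume h: "hall_condition I (T - X - {e})"
      have "T - insert e X = T - X - {e}" by blast
      then have "insert e X \<in> D" using h e X(1) by (simp add: D_def)
      then show False using X(2)[of "insert e X"] e by auto
    qed
  qed auto
qed

text \<open>
  Rado's argument: if a minimal relation satisfying Hall's condition offered two choices
  \<open>x\<close>, \<open>y\<close> for \<open>i\<close>, the sets violating the condition after the deletion of \<open>(i, x)\<close> and of
  \<open>(i, y)\<close> would contradict the submodularity of \<open>card\<close>.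
\<close>

theorem hall_representatives:
  assumes fin: "\<And>i. i \<in> I \<Longrightarrow> finite (S i)"
    and cond: "\<And>J. J \<subseteq> I \<Longrightarrow> finite J \<Longrightarrow> card J \<le> card (\<Union>i\<in>J. S i)"
  obtains f where "inj_on f I" "\<And>i. i \<in> I \<Longrightarrow> f i \<in> S i"
proof -
  have im: "Sigma I S `` J = (\<Union>i\<in>J. S i)" if "J \<subseteq> I" for J using that by auto
  have "hall_condition I (Sigma I S)" using cond im by (simp add: hall_condition_def)
  moreover have "finite (Sigma I S `` {i})" if "i \<in> I" for i using that fin im[of "{i}"] by simp
  ultimately obtain M where M: "M \<subseteq> Sigma I S" "hall_condition I M" "\<And>e. e \<in> M \<Longrightarrow> \<not> hall_condition I (M - {e})"
    using hall_minimal_exists[of I "Sigma I S"] by blast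
  have finM: "finite (M `` J)" if "J \<subseteq> I" "finite J" for J
  proof (rule finite_subset)
    show "M `` J \<subseteq> (\<Union>i\<in>J. S i)" using M(1) by blast
    show "finite (\<Union>i\<in>J. S i)" using that fin by auto
  qed
  have uniq: "x = y" if xy: "(i, x) \<in> M" "(i, y) \<in> M" for i x y
  proof (rule ccontr)
    assume ne: "x \<noteq> y"
    have iI: "i \<in> I" using that M(1) by blast
    have viol: "\<exists>J. J \<subseteq> I \<and> finite J \<and> i \<notin> J \<and> card (M `` J \<union> (M `` {i} - {t})) \<le> card J"
      if t: "(i, t) \<in> M" for t
    proof -
      obtain J where J: "J \<subseteq> I" "finite J" "card ((M - {(i, t)}) `` J) < card J"
        using M(3)[OF t] by (auto simp: hall_condition_def not_le)
      have "i \<in> J"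
      proof (rule ccontr)
        assume "i \<notin> J"
        then have "(M - {(i, t)}) `` J = M `` J" by blast
        then show False using J M(2) by (auto simp: hall_condition_def not_less)
      qed
      moreover have "M `` (J - {i}) \<union> (M `` {i} - {t}) \<subseteq> (M - {(i, t)}) `` J" using \<open>i \<in> J\<close> by auto
      then have "card (M `` (J - {i}) \<union> (M `` {i} - {t})) \<le> card ((M - {(i, t)}) `` J)"
        using finM[OF J(1,2)] by (intro card_mono) (auto intro: finite_subset)
      ultimately show ?thesis using J by (intro exI[of _ "J - {i}"]) auto
    qed
    obtain J1 where J1: "J1 \<subseteq> I" "finite J1" "i \<notin> J1" "card (M `` J1 \<union> (M `` {i} - {x})) \<le> card J1"
      using viol[OF xy(1)] by blast
    obtain J2 where J2: "J2 \<subseteq> I" "finite J2" "i \<notin> J2" "card (M `` J2 \<union> (M `` {i} - {y})) \<le> card J2"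
      using viol[OF xy(2)] by blast
    define X1 X2 where "X1 = M `` J1 \<union> (M `` {i} - {x})" and "X2 = M `` J2 \<union> (M `` {i} - {y})"
    have f: "finite X1" "finite X2"
      unfolding X1_def X2_def using finM[of J1] finM[of J2] finM[of "{i}"] J1 J2 iI by auto
    have "card (insert i (J1 \<union> J2)) \<le> card (M `` insert i (J1 \<union> J2))"
      using M(2)[unfolded hall_condition_def, rule_format, of "insert i (J1 \<union> J2)"] J1 J2 iI by simp
    \<comment> \<open>Every choice for \<open>i\<close> except \<open>x\<close> lies in
      \<open>X1\<close>, and \<open>x\<close> itself lies in \<open>X2\<close> because
      \<open>x \<noteq> y\<close>.\<close>
    also have "\<dots> \<le> card (X1 \<union> X2)" using ne f by (intro card_mono) (auto simp: X1_def X2_def)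
    finally have a: "Suc (card (J1 \<union> J2)) \<le> card (X1 \<union> X2)" using J1 J2 by simp
    have "card (J1 \<inter> J2) \<le> card (M `` (J1 \<inter> J2))"
      using M(2)[unfolded hall_condition_def, rule_format, of "J1 \<inter> J2"] J1 J2 by auto
    also have "\<dots> \<le> card (X1 \<inter> X2)" using f by (intro card_mono) (auto simp: X1_def X2_def)
    finally have b: "card (J1 \<inter> J2) \<le> card (X1 \<inter> X2)" .
    show False
      using a b card_Un_Int[OF f] card_Un_Int[OF J1(2) J2(2)] J1(4) J2(4)
      by (simp add: X1_def X2_def)
  qed
  have ex: "\<exists>x. (i, x) \<in> M" if "i \<in> I" for i
  proof (rule ccontr)
    assume "\<nexists>x. (i, x) \<in> M"
    then have "M `` {i} = {}" by blast
    then show False using M(2) that by (auto simp: hall_condition_def dest: spec[of _ "{i}"])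
  qed
  define f where "f i = (SOME x. (i, x) \<in> M)" for i
  have f: "(i, f i) \<in> M" if "i \<in> I" for i unfolding f_def using someI_ex[OF ex[OF that]] .
  show thesis
  proof (rule that)
    show "inj_on f I"
    proof (rule inj_onI, rule ccontr)
      fix i j assume ij: "i \<in> I" "j \<in> I" "f i = f j" "i \<noteq> j"
      have "M `` {i, j} \<subseteq> {f i}" using f uniq ij by auto
      then have "card (M `` {i, j}) \<le> card {f i}" by (intro card_mono) auto
      moreover have "card {i, j} \<le> card (M `` {i, j})"
        using M(2)[unfolded hall_condition_def, rule_format, of "{i, j}"] ij by simp
      ultimately show False using ij by simp
    qed
    show "f i \<in> S i" if "i \<in> I" for i using f[OF that] M(1) by auto
  qed
qed

subsection \<open>Paradoxical decompositions\<close>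

text \<open>Hall's theorem for two copies of the group, tagged by \<open>True\<close> and
  \<open>False\<close>: the copies of \<open>x\<close> are matched with products
  \<open>s \<otimes> x\<close>, \<open>s \<in> S\<close>, and \<open>t \<otimes> x\<close>,
  \<open>t \<in> T\<close>. The partners of the first copy form the \<open>P i\<close>, sorted by
  the translating element; those of the second copy form the \<open>Q i\<close>.\<close>

lemma (in group) paradoxical_decomposition_if_expanding:
  assumes S: "S \<subseteq> carrier G" "finite S" "S \<noteq> {}" and T: "T \<subseteq> carrier G" "finite T" "T \<noteq> {}"
    and exp: "\<And>A B. A \<subseteq> carrier G \<Longrightarrow> finite A \<Longrightarrow> B \<subseteq> carrier G \<Longrightarrow> finite B
      \<Longrightarrow> card A + card B \<le> card ((S <#> A) \<union> (T <#> B))"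
  shows "\<exists>P Q g h. paradoxical_decomposition G (card S) (card T) P Q g h"
proof -
  define N where "N i = (\<lambda>s. s \<otimes> fst i) ` (if snd i then S else T)" for i :: "'a \<times> bool"
  have "\<exists>f. inj_on f (carrier G \<times> UNIV) \<and> (\<forall>i\<in>carrier G \<times> UNIV. f i \<in> N i)"
  proof -
    have "card J \<le> card (\<Union>i\<in>J. N i)" if J: "J \<subseteq> carrier G \<times> UNIV" "finite J" for J
    proof -
      define A B where "A = {x. (x, True) \<in> J}" and "B = {x. (x, False) \<in> J}"
      have fin: "finite A" "finite B"
        by (rule finite_surj[OF J(2), of _ fst], force simp: A_def B_def)+
      have J_eq: "J = (\<lambda>x. (x, True)) ` A \<union> (\<lambda>x. (x, False)) ` B"
      proof (rule Set.set_eqI)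
        fix i show "i \<in> J \<longleftrightarrow> i \<in> (\<lambda>x. (x, True)) ` A \<union> (\<lambda>x. (x, False)) ` B"
          by (cases i; cases "snd i") (auto simp: A_def B_def)
      qed
      have "card J = card A + card B"
        unfolding J_eq using fin by (subst card_Un_disjoint) (auto simp: card_image inj_on_def)
      also have "\<dots> \<le> card ((S <#> A) \<union> (T <#> B))"
        using J fin by (intro exp) (auto simp: A_def B_def)
      also have "(S <#> A) \<union> (T <#> B) = (\<Union>i\<in>J. N i)"
        unfolding J_eq by (auto simp: N_def set_mult_def)
      finally show ?thesis .
    qed
    moreover have "finite (N i)" for i using S T by (simp add: N_def)
    ultimately show ?thesis using hall_representatives[of "carrier G \<times> UNIV" N] by metis
  qed
  then obtain f where inj: "inj_on f (carrier G \<times> UNIV)" and f: "\<And>i. fst i \<in> carrier G \<Longrightarrow> f i \<in> N i"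
    by (auto simp: mem_Times_iff)
  have "\<forall>x\<in>carrier G. \<exists>s\<in>S. f (x, True) = s \<otimes> x" using f by (fastforce simp: N_def)
  then obtain \<sigma> where \<sigma>: "\<And>x. x \<in> carrier G \<Longrightarrow> \<sigma> x \<in> S \<and> f (x, True) = \<sigma> x \<otimes> x" by metis
  have "\<forall>x\<in>carrier G. \<exists>t\<in>T. f (x, False) = t \<otimes> x" using f by (fastforce simp: N_def)
  then obtain \<tau> where \<tau>: "\<And>x. x \<in> carrier G \<Longrightarrow> \<tau> x \<in> T \<and> f (x, False) = \<tau> x \<otimes> x" by metis
  obtain s where s: "bij_betw s {1..card S} S" using ex_bij_betw_nat_finite_1[OF S(2)] by blast
  obtain t where t: "bij_betw t {1..card T} T" using ex_bij_betw_nat_finite_1[OF T(2)] by blast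
  \<comment> \<open>Injectivity of \<open>f\<close> makes all pieces disjoint. Translating
    \<open>P i\<close> back by \<open>inv s i\<close> gives the \<open>x\<close> with
    \<open>\<sigma> x = s i\<close>, and these sets cover the group.\<close>
  define P where "P i = {s i \<otimes> x | x. x \<in> carrier G \<and> \<sigma> x = s i}" for i
  define Q where "Q i = {t i \<otimes> x | x. x \<in> carrier G \<and> \<tau> x = t i}" for i
  have sS: "s i \<in> S" if "i \<in> {1..card S}" for i using s that by (auto simp: bij_betw_def)
  have tT: "t i \<in> T" if "i \<in> {1..card T}" for i using t that by (auto simp: bij_betw_def)
  have sc: "s i \<in> carrier G" if "i \<in> {1..card S}" for i using sS that S by blast
  have tc: "t i \<in> carrier G" if "i \<in> {1..card T}" for i using tT that T by blast
  have Pf: "\<exists>x\<in>carrier G. y = f (x, True) \<and> \<sigma> x = s i" if "y \<in> P i" for y i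
    using that \<sigma> by (force simp: P_def)
  have Qf: "\<exists>x\<in>carrier G. y = f (x, False) \<and> \<tau> x = t i" if "y \<in> Q i" for y i
    using that \<tau> by (force simp: Q_def)
  have inj': "x = x' \<and> e = e'" if "f (x, e) = f (x', e')" "x \<in> carrier G" "x' \<in> carrier G" for x x' e e'
    using inj_onD[OF inj that(1)] that by auto
  have "paradoxical_decomposition G (card S) (card T) P Q (\<lambda>i. inv s i) (\<lambda>i. inv t i)"
    unfolding paradoxical_decomposition_def
  proof (intro conjI ballI)
    show "1 \<le> card S" "1 \<le> card T" using S T by (auto simp: Suc_le_eq card_gt_0_iff)
    show "P i \<subseteq> carrier G" "inv s i \<in> carrier G" if "i \<in> {1..card S}" for i
      using sc[OF that] by (auto simp: P_def)
    show "Q i \<subseteq> carrier G" "inv t i \<in> carrier G" if "i \<in> {1..card T}" for i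
      using tc[OF that] by (auto simp: Q_def)
    show "disjoint_family_on P {1..card S}"
      unfolding disjoint_family_on_def
    proof (intro ballI impI)
      fix i j assume ij: "i \<in> {1..card S}" "j \<in> {1..card S}" "i \<noteq> j"
      from ij have "s i \<noteq> s j" using inj_on_eq_iff[OF bij_betw_imp_inj_on[OF s]] by simp
      show "P i \<inter> P j = {}"
      proof (rule equals0I)
        fix y assume "y \<in> P i \<inter> P j"
        then show False using Pf[of y i] Pf[of y j] inj' \<open>s i \<noteq> s j\<close> by force
      qed
    qed
    show "disjoint_family_on Q {1..card T}"
      unfolding disjoint_family_on_def
    proof (intro ballI impI)
      fix i j assume ij: "i \<in> {1..card T}" "j \<in> {1..card T}" "i \<noteq> j"
      from ij have "t i \<noteq> t j" using inj_on_eq_iff[OF bij_betw_imp_inj_on[OF t]] by simp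
      show "Q i \<inter> Q j = {}"
      proof (rule equals0I)
        fix y assume "y \<in> Q i \<inter> Q j"
        then show False using Qf[of y i] Qf[of y j] inj' \<open>t i \<noteq> t j\<close> by force
      qed
    qed
    show "P i \<inter> Q j = {}" for i j
    proof (rule equals0I)
      fix y assume "y \<in> P i \<inter> Q j"
      then show False using Pf[of y i] Qf[of y j] inj' by force
    qed
    show "carrier G = (\<Union>i\<in>{1..card S}. inv s i <# P i)"
    proof (intro equalityI subsetI)
      fix x assume x: "x \<in> carrier G"
      obtain i where i: "i \<in> {1..card S}" "s i = \<sigma> x"
        using \<sigma>[OF x] s by (metis bij_betw_imp_surj_on imageE)
      have "inv s i \<otimes> (s i \<otimes> x) = x" using sc[OF i(1)] x by (simp add: inv_solve_left')
      moreover have "s i \<otimes> x \<in> P i" using i x by (auto simp: P_def)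
      ultimately show "x \<in> (\<Union>i\<in>{1..card S}. inv s i <# P i)" using i(1) by (force simp: l_coset_def)
    next
      fix x assume "x \<in> (\<Union>i\<in>{1..card S}. inv s i <# P i)"
      then show "x \<in> carrier G" using sc by (auto simp: l_coset_def P_def)
    qed
    show "carrier G = (\<Union>i\<in>{1..card T}. inv t i <# Q i)"
    proof (intro equalityI subsetI)
      fix x assume x: "x \<in> carrier G"
      obtain i where i: "i \<in> {1..card T}" "t i = \<tau> x"
        using \<tau>[OF x] t by (metis bij_betw_imp_surj_on imageE)
      have "inv t i \<otimes> (t i \<otimes> x) = x" using tc[OF i(1)] x by (simp add: inv_solve_left')
      moreover have "t i \<otimes> x \<in> Q i" using i x by (auto simp: Q_def)
      ultimately show "x \<in> (\<Union>i\<in>{1..card T}. inv t i <# Q i)" using i(1) by (force simp: l_coset_def)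
    next
      fix x assume "x \<in> (\<Union>i\<in>{1..card T}. inv t i <# Q i)"
      then show "x \<in> carrier G" using tc by (auto simp: l_coset_def Q_def)
    qed
  qed
  then show ?thesis by blast
qed

lemma paradoxical_decompositionD:
  assumes "paradoxical_decomposition G m n P Q g h"
  shows "1 \<le> m" "1 \<le> n"
    and "\<And>i. i \<in> {1..m} \<Longrightarrow> P i \<subseteq> carrier G \<and> g i \<in> carrier G"
    and "\<And>i. i \<in> {1..n} \<Longrightarrow> Q i \<subseteq> carrier G \<and> h i \<in> carrier G"
    and "disjoint_family_on P {1..m}" "disjoint_family_on Q {1..n}"
    and "\<And>i j. i \<in> {1..m} \<Longrightarrow> j \<in> {1..n} \<Longrightarrow> P i \<inter> Q j = {}"
    and "carrier G = (\<Union>i\<in>{1..m}. g i <#\<^bsub>G\<^esub> P i)"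
    and "carrier G = (\<Union>i\<in>{1..n}. h i <#\<^bsub>G\<^esub> Q i)"
proof -
  note d = assms[unfolded paradoxical_decomposition_def]
  show "1 \<le> m" "1 \<le> n" "disjoint_family_on P {1..m}" "disjoint_family_on Q {1..n}"
    "carrier G = (\<Union>i\<in>{1..m}. g i <#\<^bsub>G\<^esub> P i)" "carrier G = (\<Union>i\<in>{1..n}. h i <#\<^bsub>G\<^esub> Q i)"
    by (insert d, (elim conjE, assumption)+)
  from d have "\<forall>i\<in>{1..m}. P i \<subseteq> carrier G \<and> g i \<in> carrier G" by (elim conjE)
  then show "P i \<subseteq> carrier G \<and> g i \<in> carrier G" if "i \<in> {1..m}" for i using that by blast
  from d have "\<forall>i\<in>{1..n}. Q i \<subseteq> carrier G \<and> h i \<in> carrier G" by (elim conjE)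
  then show "Q i \<subseteq> carrier G \<and> h i \<in> carrier G" if "i \<in> {1..n}" for i using that by blast
  from d have "\<forall>i\<in>{1..m}. \<forall>j\<in>{1..n}. P i \<inter> Q j = {}" by (elim conjE)
  then show "P i \<inter> Q j = {}" if "i \<in> {1..m}" "j \<in> {1..n}" for i j using that by blast
qed

text \<open>Take the preimages of the pieces and arbitrary lifts of the translating elements. This
  carries the decomposition of \<open>F / K\<close> to \<open>G\<close>.\<close>

lemma (in group_hom) paradoxical_decomposition_pullback:
  assumes surj: "h ` carrier G = carrier H" and pd: "paradoxical_decomposition H m n P Q u v"
  shows "\<exists>P' Q' u' v'. paradoxical_decomposition G m n P' Q' u' v'"
proof -
  define lift where "lift y = (SOME x. x \<in> carrier G \<and> h x = y)" for y
  have lift: "lift y \<in> carrier G" "h (lift y) = y" if "y \<in> carrier H" for y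
  proof -
    have "\<exists>x. x \<in> carrier G \<and> h x = y" using surj that by (metis imageE)
    from someI_ex[OF this] show "lift y \<in> carrier G" "h (lift y) = y" by (simp_all add: lift_def)
  qed
  define pre where "pre A = {x \<in> carrier G. h x \<in> A}" for A
  have cover: "carrier G = (\<Union>i\<in>I. lift (w i) <#\<^bsub>G\<^esub> pre (A i))"
    if w: "\<And>i. i \<in> I \<Longrightarrow> w i \<in> carrier H"
      and A: "\<And>i. i \<in> I \<Longrightarrow> A i \<subseteq> carrier H"
      and c: "carrier H = (\<Union>i\<in>I. w i <#\<^bsub>H\<^esub> A i)"
    for I :: "nat set" and w A
  proof (intro equalityI subsetI)
    fix x assume x: "x \<in> carrier G"
    then have "h x \<in> (\<Union>i\<in>I. w i <#\<^bsub>H\<^esub> A i)" using equalityD1[OF c] hom_closed by blast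
    then obtain i z where i: "i \<in> I" "z \<in> A i" "h x = w i \<otimes>\<^bsub>H\<^esub> z" by (auto simp: l_coset_def)
    have z: "z \<in> carrier H" using A i by blast
    have "h (inv\<^bsub>G\<^esub> lift (w i) \<otimes>\<^bsub>G\<^esub> x) = z"
      using x i lift[OF w[OF i(1)]] w[OF i(1)] z by (simp add: H.inv_solve_left')
    then have "inv\<^bsub>G\<^esub> lift (w i) \<otimes>\<^bsub>G\<^esub> x \<in> pre (A i)"
      using x i lift[OF w[OF i(1)]] by (simp add: pre_def)
    moreover have "x = lift (w i) \<otimes>\<^bsub>G\<^esub> (inv\<^bsub>G\<^esub> lift (w i) \<otimes>\<^bsub>G\<^esub> x)"
      using x lift[OF w[OF i(1)]] by (simp flip: G.m_assoc)
    ultimately show "x \<in> (\<Union>i\<in>I. lift (w i) <#\<^bsub>G\<^esub> pre (A i))" using i(1) by (auto simp: l_coset_def)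
  next
    fix x assume "x \<in> (\<Union>i\<in>I. lift (w i) <#\<^bsub>G\<^esub> pre (A i))"
    then show "x \<in> carrier G" using lift w by (auto simp: l_coset_def pre_def)
  qed
  note pd = paradoxical_decompositionD[OF pd]
  have "paradoxical_decomposition G m n (\<lambda>i. pre (P i)) (\<lambda>i. pre (Q i)) (\<lambda>i. lift (u i)) (\<lambda>i. lift (v i))"
    unfolding paradoxical_decomposition_def
  proof (intro conjI ballI)
    show "1 \<le> m" "1 \<le> n" using pd by blast+
    show "pre (P i) \<subseteq> carrier G" "pre (Q i) \<subseteq> carrier G" for i by (auto simp: pre_def)
    show "lift (u i) \<in> carrier G" if "i \<in> {1..m}" for i using pd lift that by blast
    show "lift (v i) \<in> carrier G" if "i \<in> {1..n}" for i using pd lift that by blast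
    show "disjoint_family_on (\<lambda>i. pre (P i)) {1..m}" "disjoint_family_on (\<lambda>i. pre (Q i)) {1..n}"
      using pd(5,6) unfolding disjoint_family_on_def pre_def by blast+
    show "pre (P i) \<inter> pre (Q j) = {}" if "i \<in> {1..m}" "j \<in> {1..n}" for i j
      using pd(7)[OF that] by (auto simp: pre_def)
    show "carrier G = (\<Union>i\<in>{1..m}. lift (u i) <#\<^bsub>G\<^esub> pre (P i))" by (rule cover[OF _ _ pd(8)]; use pd in blast)
    show "carrier G = (\<Union>i\<in>{1..n}. lift (v i) <#\<^bsub>G\<^esub> pre (Q i))" by (rule cover[OF _ _ pd(9)]; use pd in blast)
  qed
  then show ?thesis by blast
qed

section \<open>Ping-pong and the lower bound\<close>

lemma paradoxical_decomposition_swap: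
  assumes "paradoxical_decomposition G m n P Q g h"
  shows "paradoxical_decomposition G n m Q P h g"
proof -
  note d = paradoxical_decompositionD[OF assms]
  show ?thesis
    unfolding paradoxical_decomposition_def
  proof (intro conjI)
    show "\<forall>i\<in>{1..n}. \<forall>j\<in>{1..m}. Q i \<inter> P j = {}" using d(7) by (metis Int_commute)
  qed (use d in \<open>blast | fact\<close>)+
qed

text \<open>A single piece \<open>P 1\<close> with the whole group as a translate is itself the
  whole group and leaves nothing for the \<open>Q j\<close>.\<close>

lemma (in group) paradoxical_decomposition_ge2:
  assumes pd: "paradoxical_decomposition G m n P Q g h"
  shows "m \<ge> 2"
proof (rule ccontr)
  note d = paradoxical_decompositionD[OF pd]
  assume "\<not> m \<ge> 2"
  then have m: "m = 1" using d(1) by simp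
  have c: "carrier G = g 1 <# P 1" using d(8) m by simp
  have P1: "P 1 \<subseteq> carrier G" "g 1 \<in> carrier G" using d(3)[of 1] m by auto
  have "carrier G \<subseteq> P 1"
  proof
    fix x assume x: "x \<in> carrier G"
    then have "g 1 \<otimes> x \<in> g 1 <# P 1" using c P1 by (metis m_closed)
    then show "x \<in> P 1" using x P1 by (auto simp: l_coset_def subset_iff)
  qed
  then have "Q j = {}" if "j \<in> {1..n}" for j using d(7)[of 1 j] d(4)[OF that] m that by auto
  then have "carrier G = {}" using d(9) by (auto simp: l_coset_def)
  then show False using one_closed by blast
qed

text \<open>One ping-pong move: \<open>v \<otimes> t\<close> is outside the translate of
  \<open>B\<close>, hence in that of \<open>A\<close>. So \<open>inv u \<otimes> v\<close> sends the
  complement of \<open>B\<close> into \<open>A\<close>.\<close>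

lemma (in group) mem_piece_if_covering:
  assumes c: "carrier G = (u <# A) \<union> (v <# B)"
    and AB: "A \<subseteq> carrier G" "B \<subseteq> carrier G" "u \<in> carrier G" "v \<in> carrier G"
    and t: "t \<in> carrier G" "t \<notin> B"
  shows "inv u \<otimes> v \<otimes> t \<in> A"
proof -
  have "v \<otimes> t \<notin> v <# B"
  proof
    assume "v \<otimes> t \<in> v <# B"
    then obtain b where "b \<in> B" "v \<otimes> t = v \<otimes> b" by (auto simp: l_coset_def)
    then show False using t AB using Units_l_cancel[of v t b] by (auto simp: subset_iff)
  qed
  then have "v \<otimes> t \<in> u <# A" using equalityD1[OF c] AB t m_closed by blast
  then obtain w where w: "w \<in> A" "v \<otimes> t = u \<otimes> w" by (auto simp: l_coset_def)
  then have "inv u \<otimes> v \<otimes> t = w" using AB t by (simp add: m_assoc inv_solve_left' subset_iff)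
  then show ?thesis using w by simp
qed

text \<open>
  The translations \<open>x\<close>, \<open>y\<close> between the two pieces of each half play ping-pong: if \<open>z\<close> lies
  outside \<open>P 1\<close> and \<open>Q 1\<close>, then every positive power of the commutator of \<open>x\<close> and \<open>y\<close> moves
  \<open>z\<close> into \<open>P 1\<close>.
\<close>

lemma (in group) paradoxical_decomposition_2_2:
  assumes pd: "paradoxical_decomposition G 2 2 P Q g h"
  obtains x y where "x \<in> carrier G" "y \<in> carrier G"
    "\<And>k::nat. k > 0 \<Longrightarrow> (x \<otimes> y \<otimes> inv x \<otimes> inv y) [^] k \<noteq> \<one>"
proof -
  note d = paradoxical_decompositionD[OF pd]
  have I: "{1..2::nat} = {1, 2}" by auto
  have c1: "carrier G = (g 1 <# P 1) \<union> (g 2 <# P 2)" using d(8) unfolding I by blast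
  have c2: "carrier G = (h 1 <# Q 1) \<union> (h 2 <# Q 2)" using d(9) unfolding I by blast
  have c3: "carrier G = (g 2 <# P 2) \<union> (g 1 <# P 1)" by (subst Un_commute) (rule c1)
  have c4: "carrier G = (h 2 <# Q 2) \<union> (h 1 <# Q 1)" by (subst Un_commute) (rule c2)
  have cl: "P 1 \<subseteq> carrier G" "P 2 \<subseteq> carrier G" "Q 1 \<subseteq> carrier G" "Q 2 \<subseteq> carrier G"
    "g 1 \<in> carrier G" "g 2 \<in> carrier G" "h 1 \<in> carrier G" "h 2 \<in> carrier G"
    using d(3,4) by auto
  have dj: "P 1 \<inter> P 2 = {}" "Q 1 \<inter> Q 2 = {}"
    "P 1 \<inter> Q 1 = {}" "P 1 \<inter> Q 2 = {}" "P 2 \<inter> Q 1 = {}" "P 2 \<inter> Q 2 = {}"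
    using d(5,6) d(7)[of 1 1] d(7)[of 1 2] d(7)[of 2 1] d(7)[of 2 2] by (auto simp: disjoint_family_on_def)
  define x y where "x = inv g 1 \<otimes> g 2" and "y = inv h 1 \<otimes> h 2"
  have xy: "x \<in> carrier G" "y \<in> carrier G" using cl by (auto simp: x_def y_def)
  have inv: "inv x = inv g 2 \<otimes> g 1" "inv y = inv h 2 \<otimes> h 1"
    using cl by (simp_all add: x_def y_def inv_mult_group)
  have x1: "x \<otimes> t \<in> P 1" if "t \<in> carrier G" "t \<notin> P 2" for t
    unfolding x_def by (rule mem_piece_if_covering[OF c1]) (use cl that in auto)
  have x2: "inv x \<otimes> t \<in> P 2" if "t \<in> carrier G" "t \<notin> P 1" for t
    unfolding inv by (rule mem_piece_if_covering[OF c3]) (use cl that in auto)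
  have y1: "y \<otimes> t \<in> Q 1" if "t \<in> carrier G" "t \<notin> Q 2" for t
    unfolding y_def by (rule mem_piece_if_covering[OF c2]) (use cl that in auto)
  have y2: "inv y \<otimes> t \<in> Q 2" if "t \<in> carrier G" "t \<notin> Q 1" for t
    unfolding inv by (rule mem_piece_if_covering[OF c4]) (use cl that in auto)
  define w where "w = x \<otimes> y \<otimes> inv x \<otimes> inv y"
  have w: "w \<in> carrier G" using xy by (simp add: w_def)
  have Q2: "t \<in> carrier G" "t \<notin> P 1" if "t \<in> Q 2" for t using that cl(4) dj(4) by auto
  have P2: "t \<in> carrier G" "t \<notin> Q 2" if "t \<in> P 2" for t using that cl(2) dj(6) by auto
  have Q1: "t \<in> carrier G" "t \<notin> P 2" if "t \<in> Q 1" for t using that cl(3) dj(5) by auto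
  have P1: "t \<in> carrier G" "t \<notin> Q 1" if "t \<in> P 1" for t using that cl(1) dj(3) by auto
  have step: "w \<otimes> t \<in> P 1" if t: "t \<in> carrier G" "t \<notin> Q 1" for t
  proof -
    have "inv y \<otimes> t \<in> Q 2" using y2[OF t] .
    from x2[OF Q2[OF this]] have "inv x \<otimes> (inv y \<otimes> t) \<in> P 2" .
    from y1[OF P2[OF this]] have "y \<otimes> (inv x \<otimes> (inv y \<otimes> t)) \<in> Q 1" .
    from x1[OF Q1[OF this]] have "x \<otimes> (y \<otimes> (inv x \<otimes> (inv y \<otimes> t))) \<in> P 1" .
    then show ?thesis using xy t by (simp add: w_def m_assoc)
  qed
  \<comment> \<open>Any point of \<open>Q 2\<close> or of \<open>P 2\<close> serves;
    \<open>inv y\<close> or \<open>inv x\<close>, applied to \<open>\<one>\<close>, produces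
    one.\<close>
  have "\<exists>z \<in> carrier G. z \<notin> P 1 \<and> z \<notin> Q 1"
  proof (cases "\<one> \<in> P 1")
    case True
    have "inv y \<otimes> \<one> \<in> Q 2" using y2[OF P1[OF True]] .
    then show ?thesis using Q2 dj(2) by auto
  next
    case False
    have "inv x \<otimes> \<one> \<in> P 2" using x2[OF one_closed False] .
    then show ?thesis using P2 dj(1,5) by auto
  qed
  then obtain z where z: "z \<in> carrier G" "z \<notin> P 1" "z \<notin> Q 1" by blast
  have pw: "w [^] Suc k \<otimes> z \<in> P 1" for k :: nat
  proof (induction k)
    case 0
    then show ?case using step z w by simp
  next
    case (Suc k)
    have "w \<otimes> (w [^] Suc k \<otimes> z) \<in> P 1" using step[OF P1[OF Suc]] .
    then show ?case using w z by (metis m_assoc nat_pow_Suc2 nat_pow_closed)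
  qed
  show thesis
  proof (rule that[OF xy])
    fix k :: nat assume "k > 0"
    then show "(x \<otimes> y \<otimes> inv x \<otimes> inv y) [^] k \<noteq> \<one>" using pw[of "k - 1"] z by (auto simp: w_def)
  qed
qed

lemma (in group) paradoxical_decomposition_ge5:
  assumes pd: "paradoxical_decomposition G m n P Q g h"
    and tors: "\<And>x y. x \<in> carrier G \<Longrightarrow> y \<in> carrier G \<Longrightarrow>
      \<exists>k>0::nat. (x \<otimes> y \<otimes> inv x \<otimes> inv y) [^] k = \<one>"
  shows "m + n \<ge> 5"
proof (rule ccontr)
  assume "\<not> m + n \<ge> 5"
  then have "m = 2" "n = 2"
    using paradoxical_decomposition_ge2[OF pd]
      paradoxical_decomposition_ge2[OF paradoxical_decomposition_swap[OF pd]] by linarith+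
  then obtain x y where "x \<in> carrier G" "y \<in> carrier G"
    "\<And>k::nat. k > 0 \<Longrightarrow> (x \<otimes> y \<otimes> inv x \<otimes> inv y) [^] k \<noteq> \<one>"
    using paradoxical_decomposition_2_2 pd by metis
  then show False using tors by blast
qed

subsection \<open>Linear systems modulo a prime\<close>

text \<open>
  Vectors are integer functions regarded modulo \<open>p\<close>, since a field of order \<open>p\<close> is not available
  as a type for a variable \<open>p\<close>; dimensions are compared by counting residue functions.
\<close>

locale mod_system =
  fixes p :: nat and E :: "'e set" and C :: "'c set" and L :: "('e \<Rightarrow> int) \<Rightarrow> 'c \<Rightarrow> int"
  assumes prime: "prime p"
    and finite_E: "finite E"
    and finite_C: "finite C"
    and linear: "\<And>z z' k c. c \<in> C \<Longrightarrow> L (\<lambda>e. z e + k * z' e) c = L z c + k * L z' c"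
begin

definition sols :: "('e \<Rightarrow> int) set" where
  "sols = {z. \<forall>c\<in>C. int p dvd L z c}"

text \<open>Says that restricting solutions to \<open>S\<close> is onto modulo \<open>p\<close>,
  that is, that the coordinate functionals of \<open>S\<close> are linearly independent on the
  solution space.\<close>

definition independent :: "'e set \<Rightarrow> bool" where
  "independent S \<longleftrightarrow> (\<forall>y. \<exists>z\<in>sols. \<forall>e\<in>S. [z e = y e] (mod int p))"

lemma p_gt_1: "p > 1" using prime by (rule prime_gt_1_nat)

lemma sols_combine: "z \<in> sols \<Longrightarrow> z' \<in> sols \<Longrightarrow> (\<lambda>e. z e + k * z' e) \<in> sols"
  by (auto simp: sols_def linear)

lemma card_residue_functions: "finite S \<Longrightarrow> card (S \<rightarrow>\<^sub>E {0..<int p}) = p ^ card S"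
  by (simp add: card_PiE)

text \<open>A maximal independent superset works: if a solution vanishing on \<open>J\<close> were
  nonzero at \<open>e\<close>, its multiples would adjust the value at \<open>e\<close> freely, and
  \<open>e\<close> could be added to \<open>J\<close>.\<close>

lemma extend_to_spanning:
  assumes "S \<subseteq> E" "independent S"
  obtains J where "S \<subseteq> J" "J \<subseteq> E" "independent J"
    "\<And>z e. z \<in> sols \<Longrightarrow> (\<And>e. e \<in> J \<Longrightarrow> int p dvd z e) \<Longrightarrow> e \<in> E \<Longrightarrow> int p dvd z e"
proof -
  define \<J> where "\<J> = {J. J \<subseteq> E \<and> S \<subseteq> J \<and> independent J}"
  have "finite \<J>" using finite_E by (simp add: \<J>_def)
  moreover have "S \<in> \<J>" using assms by (simp add: \<J>_def)
  ultimately have "\<exists>J\<in>\<J>. S \<subseteq> J \<and> (\<forall>J'\<in>\<J>. J \<subseteq> J' \<longrightarrow> J = J')" using finite_has_maximal2[of \<J> S] by simp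
  then obtain J where J': "J \<in> \<J>" and max: "\<forall>J'\<in>\<J>. J \<subseteq> J' \<longrightarrow> J = J'" by blast
  have J: "S \<subseteq> J" "J \<subseteq> E" "independent J" using J' by (auto simp: \<J>_def)
  show thesis
  proof (rule that)
    show "S \<subseteq> J" "J \<subseteq> E" "independent J" by fact+
    fix z e assume z: "z \<in> sols" "\<And>e. e \<in> J \<Longrightarrow> int p dvd z e" and e: "e \<in> E"
    show "int p dvd z e"
    proof (rule ccontr)
      assume nd: "\<not> int p dvd z e"
      then have "coprime (z e) (int p)"
        using prime by (metis coprime_commute prime_imp_coprime prime_nat_int_transfer)
      then obtain u where u: "[z e * u = 1] (mod int p)" using cong_solve_coprime_int by blast
      have "independent (insert e J)"
        unfolding independent_def
      proof
        fix y
        obtain x where x: "x \<in> sols" "\<And>e. e \<in> J \<Longrightarrow> [x e = y e] (mod int p)"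
          using J(3) unfolding independent_def by blast
        \<comment> \<open>As \<open>u\<close> inverts \<open>z e\<close> modulo \<open>p\<close>,
          this multiple of \<open>z\<close> corrects the value at \<open>e\<close> and preserves the
          values on \<open>J\<close> modulo \<open>p\<close>.\<close>
        define x' where "x' = (\<lambda>f. x f + (u * (y e - x e)) * z f)"
        have "x' \<in> sols" unfolding x'_def by (rule sols_combine) (use x z in auto)
        moreover have "[x' f = y f] (mod int p)" if "f \<in> J" for f
        proof -
          have "[x f + (u * (y e - x e)) * z f = y f + (u * (y e - x e)) * 0] (mod int p)"
            using x(2)[OF that] z(2)[OF that] by (intro cong_add cong_mult) (auto simp: cong_0_iff)
          then show ?thesis by (simp add: x'_def)
        qed
        moreover have "[x' e = y e] (mod int p)"
        proof -
          have "[x e + (z e * u) * (y e - x e) = x e + 1 * (y e - x e)] (mod int p)"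
            by (intro cong_add cong_mult u cong_refl)
          then show ?thesis by (simp add: x'_def ac_simps)
        qed
        ultimately show "\<exists>z\<in>sols. \<forall>f\<in>insert e J. [z f = y f] (mod int p)" by auto
      qed
      then have "insert e J \<in> \<J>" using J e by (auto simp: \<J>_def)
      then have "e \<in> J" using max by blast
      then show False using z nd by blast
    qed
  qed
qed

lemma residue_eq_if_dvd:
  assumes "x \<in> {0..<int p}" "y \<in> {0..<int p}" "int p dvd x - y"
  shows "x = y"
  using assms by (metis atLeastLessThan_iff mod_eq_dvd_iff mod_pos_pos_trivial)

text \<open>A residue function is determined by its values on \<open>J\<close> together with those
  of the constraints: two that agree in both differ by a solution vanishing on \<open>J\<close>.
  This is the rank inequality in counted form.\<close>

lemma card_le_spanning:
  assumes "J \<subseteq> E"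
    and span: "\<And>z e. z \<in> sols \<Longrightarrow> (\<And>e. e \<in> J \<Longrightarrow> int p dvd z e) \<Longrightarrow> e \<in> E \<Longrightarrow> int p dvd z e"
  shows "card E \<le> card J + card C"
proof -
  have finJ: "finite J" using assms finite_E finite_subset by blast
  define \<Phi> where "\<Phi> z = (restrict z J, restrict (\<lambda>c. L z c mod int p) C)" for z
  have "card (E \<rightarrow>\<^sub>E {0..<int p}) \<le> card ((J \<rightarrow>\<^sub>E {0..<int p}) \<times> (C \<rightarrow>\<^sub>E {0..<int p}))"
  proof (rule card_inj_on_le[of \<Phi>])
    show "inj_on \<Phi> (E \<rightarrow>\<^sub>E {0..<int p})"
    proof (rule inj_onI)
      fix z z' assume z: "z \<in> E \<rightarrow>\<^sub>E {0..<int p}" "z' \<in> E \<rightarrow>\<^sub>E {0..<int p}" "\<Phi> z = \<Phi> z'"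
      have J: "z e = z' e" if "e \<in> J" for e
        using z(3) that unfolding \<Phi>_def by (metis Pair_inject restrict_apply')
      have "L z c mod int p = L z' c mod int p" if "c \<in> C" for c
        using z(3) that unfolding \<Phi>_def by (metis (mono_tags, lifting) Pair_inject restrict_apply')
      then have "int p dvd L z c - L z' c" if "c \<in> C" for c using that by (metis mod_eq_dvd_iff)
      then have "(\<lambda>e. z e - z' e) \<in> sols" using linear[of _ z "-1" z'] by (simp add: sols_def)
      then have "int p dvd z e - z' e" if "e \<in> E" for e using span[of "\<lambda>e. z e - z' e" e] J that by simp
      then have "z e = z' e" if "e \<in> E" for e using that z residue_eq_if_dvd by (meson PiE_mem)
      then show "z = z'" using z by (meson PiE_ext)
    qed
    show "\<Phi> ` (E \<rightarrow>\<^sub>E {0..<int p}) \<subseteq> (J \<rightarrow>\<^sub>E {0..<int p}) \<times> (C \<rightarrow>\<^sub>E {0..<int p})"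
      using assms(1) p_gt_1 by (auto simp: \<Phi>_def PiE_iff)
    show "finite ((J \<rightarrow>\<^sub>E {0..<int p}) \<times> (C \<rightarrow>\<^sub>E {0..<int p}))"
      using finJ finite_C by (intro finite_cartesian_product finite_PiE) auto
  qed
  then have "p ^ card E \<le> p ^ (card J + card C)"
    using finite_E finJ finite_C by (simp add: card_cartesian_product card_residue_functions power_add)
  then show ?thesis using p_gt_1 by simp
qed

text \<open>Realize each prescription on \<open>S\<close> by a solution. Its values under
  \<open>\<Theta>\<close> recover the prescription, so there are at most \<open>p ^ card U\<close>
  of them.\<close>

lemma card_independent_le:
  assumes ind: "independent S" and fin: "finite S" "finite U"
    and det: "\<And>z z'. z \<in> sols \<Longrightarrow> z' \<in> sols \<Longrightarrow> (\<And>u. u \<in> U \<Longrightarrow> [\<Theta> z u = \<Theta> z' u] (mod int p))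
      \<Longrightarrow> (\<And>e. e \<in> S \<Longrightarrow> [z e = z' e] (mod int p))"
  shows "card S \<le> card U"
proof -
  obtain \<zeta> where \<zeta>: "\<And>y. \<zeta> y \<in> sols" "\<And>y e. e \<in> S \<Longrightarrow> [\<zeta> y e = y e] (mod int p)"
    using ind unfolding independent_def by metis
  define \<Phi> where "\<Phi> y = restrict (\<lambda>u. \<Theta> (\<zeta> y) u mod int p) U" for y
  have "card (S \<rightarrow>\<^sub>E {0..<int p}) \<le> card (U \<rightarrow>\<^sub>E {0..<int p})"
  proof (rule card_inj_on_le[of \<Phi>])
    show "inj_on \<Phi> (S \<rightarrow>\<^sub>E {0..<int p})"
    proof (rule inj_onI)
      fix y y' assume y: "y \<in> S \<rightarrow>\<^sub>E {0..<int p}" "y' \<in> S \<rightarrow>\<^sub>E {0..<int p}" "\<Phi> y = \<Phi> y'"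
      have "[\<Theta> (\<zeta> y) u = \<Theta> (\<zeta> y') u] (mod int p)" if "u \<in> U" for u
        using fun_cong[OF y(3), of u] that by (simp add: \<Phi>_def cong_def)
      then have "[\<zeta> y e = \<zeta> y' e] (mod int p)" if "e \<in> S" for e
        using det[OF \<zeta>(1) \<zeta>(1)] that by blast
      then have "[y e = y' e] (mod int p)" if "e \<in> S" for e
        using \<zeta>(2)[OF that, of y] \<zeta>(2)[OF that, of y'] that by (metis cong_sym cong_trans)
      then have "y e = y' e" if "e \<in> S" for e
        using that y residue_eq_if_dvd by (meson PiE_mem cong_iff_dvd_diff)
      then show "y = y'" using y by (meson PiE_ext)
    qed
    show "\<Phi> ` (S \<rightarrow>\<^sub>E {0..<int p}) \<subseteq> U \<rightarrow>\<^sub>E {0..<int p}" using p_gt_1 by (auto simp: \<Phi>_def)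
    show "finite (U \<rightarrow>\<^sub>E {0..<int p})" using fin by (intro finite_PiE) auto
  qed
  then have "p ^ card S \<le> p ^ card U" using fin by (simp add: card_residue_functions)
  then show ?thesis using p_gt_1 by simp
qed

lemma independent_mono: "independent S \<Longrightarrow> S' \<subseteq> S \<Longrightarrow> independent S'"
  unfolding independent_def by (meson subsetD)

end

subsection \<open>Potentials on free groups\<close>

text \<open>A line integral in the Cayley graph of left multiplication. The word is read from its
  right end; the edge \<open>(h, s)\<close> leads from \<open>h\<close> to \<open>s h\<close>, and
  an inverse letter traverses it backwards, hence the sign.\<close>

fun path_sum :: "('a, 'b) monoid_scheme \<Rightarrow> ('a \<Rightarrow> 'a \<Rightarrow> int) \<Rightarrow> ('a \<times> bool) list \<Rightarrow> 'a \<Rightarrow> int" where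
  "path_sum F y [] g = 0"
| "path_sum F y (l # w) g = path_sum F y w g +
    (if snd l then y (word_value F w \<otimes>\<^bsub>F\<^esub> g) (fst l)
     else - y (inv\<^bsub>F\<^esub> fst l \<otimes>\<^bsub>F\<^esub> (word_value F w \<otimes>\<^bsub>F\<^esub> g)) (fst l))"

definition inverse_word :: "('a \<times> bool) list \<Rightarrow> ('a \<times> bool) list" where
  "inverse_word w = rev (map (\<lambda>l. (fst l, \<not> snd l)) w)"

lemma not_reduced_wordE:
  assumes "\<not> reduced_word w"
  obtains u l l' v where "w = u @ [l, l'] @ v" "fst l = fst l'" "snd l \<noteq> snd l'"
  using assms
proof (induction w arbitrary: thesis rule: induct_list012)
  case 1
  then show ?case by (simp add: reduced_word_def)
next
  case (2 x)
  then show ?case by (simp add: reduced_word_def)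
next
  case (3 x y zs)
  show ?case
  proof (cases "fst x = fst y \<and> snd x \<noteq> snd y")
    case True
    then show ?thesis using 3(3)[of "[]" x y zs] by simp
  next
    case False
    then have "\<not> reduced_word (y # zs)" using 3(4) by (simp add: reduced_word_def)
    then obtain u l l' v where "y # zs = u @ [l, l'] @ v" "fst l = fst l'" "snd l \<noteq> snd l'"
      using 3(2) by blast
    then show ?thesis using 3(3)[of "x # u"] by simp
  qed
qed

section \<open>Sums along paths in the Cayley graph\<close>

context group
begin

lemma letter_value_closed: "fst l \<in> carrier G \<Longrightarrow> letter_value G l \<in> carrier G"
  by (simp add: letter_value_def)

lemma word_value_Nil: "word_value G [] = \<one>"
  by (simp add: word_value_def)

lemma word_value_Cons: "word_value G (l # w) = letter_value G l \<otimes> word_value G w"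
  by (simp add: word_value_def)

lemma word_value_closed: "fst ` set w \<subseteq> carrier G \<Longrightarrow> word_value G w \<in> carrier G"
  by (induction w) (auto simp: word_value_Nil word_value_Cons letter_value_closed)

lemma word_value_append:
  "fst ` set u \<subseteq> carrier G \<Longrightarrow> fst ` set v \<subseteq> carrier G
    \<Longrightarrow> word_value G (u @ v) = word_value G u \<otimes> word_value G v"
  by (induction u)
    (auto simp: word_value_Nil word_value_Cons letter_value_closed word_value_closed m_assoc)

lemma path_sum_append:
  "fst ` set u \<subseteq> carrier G \<Longrightarrow> fst ` set v \<subseteq> carrier G \<Longrightarrow> g \<in> carrier G
    \<Longrightarrow> path_sum G y (u @ v) g = path_sum G y u (word_value G v \<otimes> g) + path_sum G y v g"
  by (induction u) (auto simp: word_value_append word_value_closed m_assoc)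

lemma cancelling_pair:
  assumes "fst l = fst l'" "snd l \<noteq> snd l'" "fst l' \<in> carrier G"
  shows "word_value G [l, l'] = \<one>" "g \<in> carrier G \<Longrightarrow> path_sum G y [l, l'] g = 0"
proof -
  have c: "letter_value G l \<otimes> letter_value G l' = \<one>"
    using assms by (cases "snd l") (auto simp: letter_value_def)
  then show "word_value G [l, l'] = \<one>"
    using assms by (simp add: word_value_Nil word_value_Cons letter_value_closed)
  show "path_sum G y [l, l'] g = 0" if "g \<in> carrier G"
    using assms that by (cases "snd l")
      (auto simp: word_value_Nil word_value_Cons letter_value_def simp flip: m_assoc)
qed

lemma inverse_word_set: "fst ` set (inverse_word w) = fst ` set w"
  by (auto simp: inverse_word_def image_iff) force+

lemma word_value_inverse:
  assumes "fst ` set w \<subseteq> carrier G"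
  shows "word_value G (inverse_word w) = inv word_value G w"
  using assms
proof (induction w)
  case Nil
  then show ?case by (simp add: inverse_word_def word_value_Nil)
next
  case (Cons l w)
  have "inverse_word (l # w) = inverse_word w @ [(fst l, \<not> snd l)]" by (simp add: inverse_word_def)
  then show ?case
    using Cons inverse_word_set[of w]
    by (cases "snd l") (auto simp: word_value_append word_value_Nil word_value_Cons letter_value_def
        word_value_closed inv_mult_group)
qed

text \<open>Induction on the length: by freeness a nonempty trivial word contains a cancelling pair,
  which traverses one edge in both directions and can be deleted.\<close>

lemma path_sum_trivial:
  assumes X: "free_basis G X"
  shows "fst ` set w \<subseteq> X \<Longrightarrow> word_value G w = \<one> \<Longrightarrow> g \<in> carrier G \<Longrightarrow> path_sum G y w g = 0"
proof (induction w rule: length_induct)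
  case (1 w)
  have XG: "X \<subseteq> carrier G" using X by (simp add: free_basis_def)
  show ?case
  proof (cases "w = []")
    case False
    then have "\<not> reduced_word w" using X 1 by (auto simp: free_basis_def)
    then obtain u l l' v where w: "w = u @ [l, l'] @ v" and l: "fst l = fst l'" "snd l \<noteq> snd l'"
      using not_reduced_wordE by blast
    have s: "fst ` set u \<subseteq> carrier G" "fst ` set v \<subseteq> carrier G" "fst l' \<in> carrier G" "fst l \<in> carrier G"
      "fst ` set [l, l'] \<subseteq> carrier G" "fst ` set ([l, l'] @ v) \<subseteq> carrier G"
      using 1(2) w XG l by auto
    have val: "word_value G w = word_value G (u @ v)"
      using s cancelling_pair(1)[OF l s(3)]
      by (simp add: w word_value_append[OF s(1,6)] word_value_append[OF s(5,2)] word_value_append[OF s(1,2)]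
          word_value_closed del: append_Cons set_append set_simps)
    have "path_sum G y (u @ v) g = 0"
      using 1(1)[rule_format, of "u @ v"] 1(2,3,4) w val by auto
    moreover have "path_sum G y w g = path_sum G y (u @ v) g"
      using s 1(4) cancelling_pair[OF l s(3)]
      by (simp add: w path_sum_append[OF s(1,6)] path_sum_append[OF s(5,2)] path_sum_append[OF s(1,2)]
          word_value_append[OF s(5,2)] word_value_closed del: append_Cons set_append set_simps path_sum.simps)
    ultimately show ?thesis by simp
  qed simp
qed

lemma path_sum_eq:
  assumes X: "free_basis G X" and u: "fst ` set u \<subseteq> X" and v: "fst ` set v \<subseteq> X"
    and eq: "word_value G u = word_value G v" and g: "g \<in> carrier G"
  shows "path_sum G y u g = path_sum G y v g"
proof -
  have XG: "X \<subseteq> carrier G" using X by (simp add: free_basis_def)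
  \<comment> \<open>The path of \<open>w\<close> followed by that of \<open>u\<close> backwards is
    closed. For \<open>w = u\<close> and \<open>w = v\<close> the backward part contributes the same
    term.\<close>
  have 0: "path_sum G y (inverse_word u) (word_value G u \<otimes> g) + path_sum G y w g = 0"
    if w: "fst ` set w \<subseteq> X" "word_value G w = word_value G u" for w
  proof -
    have "path_sum G y (inverse_word u @ w) g = 0"
    proof (rule path_sum_trivial[OF X])
      show "fst ` set (inverse_word u @ w) \<subseteq> X" using inverse_word_set[of u] u w by auto
      have "word_value G (inverse_word u @ w) = inv word_value G u \<otimes> word_value G u"
        using inverse_word_set[of u] u w XG by (subst word_value_append) (auto simp: word_value_inverse)
      then show "word_value G (inverse_word u @ w) = \<one>" using u XG word_value_closed[of u] by auto
    qed (rule g)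
    then show ?thesis using inverse_word_set[of u] u w XG g by (subst (asm) path_sum_append) auto
  qed
  from 0[OF u refl] 0[OF v eq[symmetric]] show ?thesis by simp
qed

lemma path_sum_linear:
  "path_sum G (\<lambda>g s. y g s + k * y' g s) w g = path_sum G y w g + k * path_sum G y' w g"
  by (induction w) (auto simp: algebra_simps)

lemma generate_word_exists:
  assumes "X \<subseteq> carrier G" "g \<in> generate G X"
  shows "\<exists>w. fst ` set w \<subseteq> X \<and> word_value G w = g"
  using assms(2)
proof (induction rule: generate.induct)
  case one
  then show ?case by (intro exI[of _ "[]"]) (simp add: word_value_Nil)
next
  case (incl h)
  then show ?case using assms(1)
    by (intro exI[of _ "[(h, True)]"]) (auto simp: word_value_Nil word_value_Cons letter_value_def)
next
  case (inv h)
  then show ?case using assms(1)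
    by (intro exI[of _ "[(h, False)]"]) (auto simp: word_value_Nil word_value_Cons letter_value_def)
next
  case (eng h1 h2)
  then obtain u v where "fst ` set u \<subseteq> X" "word_value G u = h1" "fst ` set v \<subseteq> X" "word_value G v = h2"
    by blast
  then show ?case using assms(1) by (intro exI[of _ "u @ v"]) (auto simp: word_value_append)
qed

text \<open>
  The Cayley graph of a free group is a tree, so every function \<open>y\<close> on its edges is the
  differential of a potential; the potential is chosen to depend linearly on \<open>y\<close>.
\<close>

lemma potential_exists:
  assumes X: "free_basis G X"
  obtains \<Phi> :: "('a \<Rightarrow> 'a \<Rightarrow> int) \<Rightarrow> 'a \<Rightarrow> int" where
    "\<And>y g s. g \<in> carrier G \<Longrightarrow> s \<in> X \<Longrightarrow> \<Phi> y (s \<otimes> g) = \<Phi> y g + y g s"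
    "\<And>y y' k g. \<Phi> (\<lambda>g s. y g s + k * y' g s) g = \<Phi> y g + k * \<Phi> y' g"
proof -
  have XG: "X \<subseteq> carrier G" "generate G X = carrier G" using X by (auto simp: free_basis_def)
  define w where "w g = (SOME w. fst ` set w \<subseteq> X \<and> word_value G w = g)" for g
  have w: "fst ` set (w g) \<subseteq> X" "word_value G (w g) = g" if "g \<in> carrier G" for g
    using someI_ex[OF generate_word_exists[OF XG(1), of g]] that XG by (auto simp: w_def)
  show thesis
  proof (rule that[of "\<lambda>y g. path_sum G y (w g) \<one>"])
    fix y g s assume gs: "g \<in> carrier G" "s \<in> X"
    then have sg: "s \<otimes> g \<in> carrier G" using XG by auto
    have "path_sum G y (w (s \<otimes> g)) \<one> = path_sum G y ((s, True) # w g) \<one>"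
      using w[OF gs(1)] w[OF sg] gs by (intro path_sum_eq[OF X]) (auto simp: word_value_Cons letter_value_def)
    then show "path_sum G y (w (s \<otimes> g)) \<one> = path_sum G y (w g) \<one> + y g s" using w[OF gs(1)] gs by simp
  qed (rule path_sum_linear)
qed

text \<open>With \<open>d = 0\<close> this says that a function constant along the edges of the
  Cayley graph is constant.\<close>

lemma generate_increment_induct:
  assumes XG: "X \<subseteq> carrier G" "generate G X = carrier G"
    and step: "\<And>s g. s \<in> X \<Longrightarrow> g \<in> carrier G \<Longrightarrow> (d::int) dvd f (s \<otimes> g) - f g"
    and "x \<in> carrier G" "g \<in> carrier G"
  shows "d dvd f (x \<otimes> g) - f g"
proof -
  have "x \<in> generate G X \<Longrightarrow> \<forall>g\<in>carrier G. x \<in> carrier G \<and> d dvd f (x \<otimes> g) - f g"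
  proof (induction rule: generate.induct)
    case one
    then show ?case by simp
  next
    case (incl h)
    then show ?case using step XG by auto
  next
    case (inv h)
    show ?case
    proof
      fix g assume g: "g \<in> carrier G"
      have h: "h \<in> carrier G" using inv XG by auto
      have "d dvd f (h \<otimes> (inv h \<otimes> g)) - f (inv h \<otimes> g)" using step[OF inv] g h by simp
      then have "d dvd f g - f (inv h \<otimes> g)" using g h by (simp flip: m_assoc)
      then show "inv h \<in> carrier G \<and> d dvd f (inv h \<otimes> g) - f g" using h by (simp add: dvd_diff_commute)
    qed
  next
    case (eng h1 h2)
    show ?case
    proof
      fix g assume g: "g \<in> carrier G"
      have h: "h1 \<in> carrier G" "h2 \<in> carrier G" using eng g by auto
      have "d dvd (f (h1 \<otimes> (h2 \<otimes> g)) - f (h2 \<otimes> g)) + (f (h2 \<otimes> g) - f g)"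
        using eng g h by (intro dvd_add) auto
      then show "h1 \<otimes> h2 \<in> carrier G \<and> d dvd f (h1 \<otimes> h2 \<otimes> g) - f g" using g h by (simp add: m_assoc)
    qed
  qed
  then show ?thesis using assms by auto
qed

end

text \<open>The potential of the indicator of the edges labelled \<open>a\<close> counts the
  occurrences of \<open>a\<close> with sign.\<close>

lemma (in group) exists_exponent_sum:
  assumes X: "free_basis G X" and a: "a \<in> X"
  obtains \<chi> :: "'a \<Rightarrow> int" where
    "\<And>x y. x \<in> carrier G \<Longrightarrow> y \<in> carrier G \<Longrightarrow> \<chi> (x \<otimes> y) = \<chi> x + \<chi> y" "\<chi> a = 1"
proof -
  have XG: "X \<subseteq> carrier G" "generate G X = carrier G" using X by (auto simp: free_basis_def)
  obtain \<Phi> :: "('a \<Rightarrow> 'a \<Rightarrow> int) \<Rightarrow> 'a \<Rightarrow> int"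
    where \<Phi>: "\<And>y g s. g \<in> carrier G \<Longrightarrow> s \<in> X \<Longrightarrow> \<Phi> y (s \<otimes> g) = \<Phi> y g + y g s"
    by (rule potential_exists[OF X]) (rule that)
  define \<phi> where "\<phi> = \<Phi> (\<lambda>g s. of_bool (s = a))"
  have \<phi>: "\<phi> (s \<otimes> g) = \<phi> g + of_bool (s = a)" if "g \<in> carrier G" "s \<in> X" for g s
    using \<Phi>[OF that] by (simp add: \<phi>_def)
  have add: "\<phi> (x \<otimes> y) - \<phi> x = \<phi> y - \<phi> \<one>" if "x \<in> carrier G" "y \<in> carrier G" for x y
  proof -
    \<comment> \<open>For fixed \<open>y\<close> this difference is constant along edges, since the
      increment of \<open>\<phi>\<close> depends only on the label.\<close>
    have "0 dvd (\<lambda>x. \<phi> (x \<otimes> y) - \<phi> x) (x \<otimes> \<one>) - (\<lambda>x. \<phi> (x \<otimes> y) - \<phi> x) \<one>"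
      by (rule generate_increment_induct[OF XG]) (use that \<phi> XG in \<open>auto simp: m_assoc subset_iff\<close>)
    then show ?thesis using that by simp
  qed
  show thesis
  proof (rule that[of "\<lambda>x. \<phi> x - \<phi> \<one>"])
    show "\<phi> (x \<otimes> y) - \<phi> \<one> = (\<phi> x - \<phi> \<one>) + (\<phi> y - \<phi> \<one>)" if "x \<in> carrier G" "y \<in> carrier G" for x y
      using add[OF that] by simp
    show "\<phi> a - \<phi> \<one> = 1" using \<phi>[OF one_closed a] a XG by auto
  qed
qed

subsection \<open>Normal subgroups of finite index\<close>

lemma (in group) normal_Inter:
  assumes "\<And>N. N \<in> \<N> \<Longrightarrow> N \<lhd> G" "\<N> \<noteq> {}"
  shows "\<Inter>\<N> \<lhd> G"
proof (rule normal_invI)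
  show "subgroup (\<Inter>\<N>) G"
    using assms by (intro subgroups_Inter) (auto intro: normal_imp_subgroup)
  show "x \<otimes> h \<otimes> inv x \<in> \<Inter>\<N>" if "h \<in> \<Inter>\<N>" "x \<in> carrier G" for x h
  proof
    fix N assume "N \<in> \<N>"
    then show "x \<otimes> h \<otimes> inv x \<in> N"
      using normal.inv_op_closed2[OF assms(1)] that by auto
  qed
qed

lemma (in group) carrier_normal: "carrier G \<lhd> G"
  by (rule normal_invI) (auto intro: subgroup_self)

lemma (in group) normal_closure_normal:
  assumes "R \<subseteq> carrier G"
  shows "normal_closure G R \<lhd> G" "R \<subseteq> normal_closure G R"
  unfolding normal_closure_def using assms carrier_normal by (intro normal_Inter) auto

lemma (in group) rcos_eq_iff:
  assumes "subgroup H G" "x \<in> carrier G" "y \<in> carrier G"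
  shows "H #> x = H #> y \<longleftrightarrow> x \<otimes> inv y \<in> H"
proof -
  have "x \<in> H #> y \<longleftrightarrow> x \<otimes> inv y \<in> H"
    using subgroup.rcos_module[OF assms(1) is_group assms(3,2)] .
  moreover have "x \<in> H #> y \<longleftrightarrow> H #> x = H #> y"
    using assms rcos_self repr_independence by metis
  ultimately show ?thesis by simp
qed

lemma (in group) finite_rcosets_if:
  assumes H: "subgroup H G" and fin: "finite (f ` carrier G)"
    and eq: "\<And>x y. x \<in> carrier G \<Longrightarrow> y \<in> carrier G \<Longrightarrow> f x = f y \<Longrightarrow> x \<otimes> inv y \<in> H"
  shows "finite (rcosets H)"
proof -
  define \<rho> where "\<rho> v = (SOME x. x \<in> carrier G \<and> f x = v)" for v
  have "H #> x = H #> \<rho> (f x)" if x: "x \<in> carrier G" for x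
  proof -
    have "\<exists>y. y \<in> carrier G \<and> f y = f x" using x by blast
    from someI_ex[OF this] have y: "\<rho> (f x) \<in> carrier G" "f (\<rho> (f x)) = f x" by (simp_all add: \<rho>_def)
    have "x \<in> H #> \<rho> (f x)"
      using eq[OF x y(1)] x y subgroup.rcos_module_rev[OF H is_group y(1) x] by simp
    then show ?thesis using repr_independence[OF _ y(1) H] by simp
  qed
  then have "rcosets H \<subseteq> (\<lambda>v. H #> \<rho> v) ` f ` carrier G" by (auto simp: RCOSETS_def)
  then show ?thesis using fin by (meson finite_imageI finite_subset)
qed

text \<open>Modulo a normal subgroup contained in \<open>K\<close>, the residue of
  \<open>\<chi>\<close> is still visible; this forces long cycles of \<open>a\<close>. Commutators
  lie in \<open>K\<close> because the values of \<open>\<chi>\<close> commute.\<close>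

lemma (in group) derived_finite_index_kernel:
  fixes \<chi> :: "'a \<Rightarrow> int"
  assumes add: "\<And>x y. x \<in> carrier G \<Longrightarrow> y \<in> carrier G \<Longrightarrow> \<chi> (x \<otimes> y) = \<chi> x + \<chi> y" and m: "m > 0"
  defines "K \<equiv> {x \<in> carrier G. int m dvd \<chi> x}"
  shows "K \<lhd> G" "finite (rcosets K)" "derived G (carrier G) \<subseteq> K"
proof -
  have one: "\<chi> \<one> = 0" using add[of \<one> \<one>] by simp
  have inv: "\<chi> (inv x) = - \<chi> x" if "x \<in> carrier G" for x
    using add[of x "inv x"] that one by simp
  have sub: "subgroup K G"
    by (rule subgroupI) (auto simp: K_def add inv one intro: exI[of _ \<one>])
  show "K \<lhd> G" by (rule normal_invI[OF sub]) (auto simp: K_def add inv)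
  show "finite (rcosets K)"
  proof (rule finite_rcosets_if[OF sub, of "\<lambda>x. \<chi> x mod int m"])
    have "(\<lambda>x. \<chi> x mod int m) ` carrier G \<subseteq> {0..<int m}" using m by auto
    then show "finite ((\<lambda>x. \<chi> x mod int m) ` carrier G)" by (rule finite_subset) simp
  qed (auto simp: K_def add inv mod_eq_dvd_iff)
  show "derived G (carrier G) \<subseteq> K"
    unfolding derived_def by (rule generate_subgroup_incl[OF _ sub]) (auto simp: K_def add inv)
qed

text \<open>The quotient by this subgroup is the largest residually finite quotient of
  \<open>F\<close> in which \<open>R\<close> is trivial.\<close>

definition profinite_kernel :: "('a, 'b) monoid_scheme \<Rightarrow> 'a set \<Rightarrow> 'a set" where
  "profinite_kernel F R = \<Inter>{N. N \<lhd> F \<and> finite (rcosets\<^bsub>F\<^esub> N) \<and> R \<subseteq> N}"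

lemma (in group) profinite_kernel_normal:
  assumes "R \<subseteq> carrier G"
  shows "profinite_kernel G R \<lhd> G"
proof -
  have "rcosets (carrier G) = {carrier G}"
    using coset_join2[OF _ subgroup_self] by (force simp: RCOSETS_def)
  then show ?thesis
    unfolding profinite_kernel_def using assms carrier_normal
    by (intro normal_Inter) (auto intro!: exI[of _ "carrier G"])
qed

lemma (in group) normal_closure_subset_profinite_kernel:
  "normal_closure G R \<subseteq> profinite_kernel G R"
  by (auto simp: normal_closure_def profinite_kernel_def)

text \<open>Intersect \<open>N0\<close> with one finite-index subgroup for each point of
  \<open>D\<close>. A coset of a finite intersection is determined by the tuple of cosets, so the
  index stays finite.\<close>

lemma (in group) finite_index_separation:
  assumes N: "N0 \<lhd> G" "finite (rcosets N0)" "R \<subseteq> N0"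
    and D: "finite D" "\<And>x. x \<in> D \<Longrightarrow> x \<notin> profinite_kernel G R"
  obtains H where "H \<lhd> G" "finite (rcosets H)" "R \<subseteq> H" "H \<subseteq> N0" "H \<inter> D = {}"
proof -
  have "\<exists>N. N \<lhd> G \<and> finite (rcosets N) \<and> R \<subseteq> N \<and> x \<notin> N" if "x \<in> D" for x
    using D(2)[OF that] by (auto simp: profinite_kernel_def)
  then obtain \<nu> where \<nu>: "\<And>x. x \<in> D \<Longrightarrow> \<nu> x \<lhd> G \<and> finite (rcosets (\<nu> x)) \<and> R \<subseteq> \<nu> x \<and> x \<notin> \<nu> x"
    by metis
  define \<N> where "\<N> = insert N0 (\<nu> ` D)"
  have \<N>: "finite \<N>" "\<N> \<noteq> {}" "\<And>N. N \<in> \<N> \<Longrightarrow> N \<lhd> G \<and> finite (rcosets N) \<and> R \<subseteq> N"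
    using \<nu> N D(1) by (auto simp: \<N>_def)
  have normal: "\<Inter>\<N> \<lhd> G" using \<N> by (intro normal_Inter) auto
  show thesis
  proof (rule that[OF normal])
    show "R \<subseteq> \<Inter>\<N>" using \<N> by blast
    show "\<Inter>\<N> \<subseteq> N0" "\<Inter>\<N> \<inter> D = {}" using \<nu> by (auto simp: \<N>_def)
    show "finite (rcosets (\<Inter>\<N>))"
    proof (rule finite_rcosets_if[OF normal_imp_subgroup[OF normal], of "\<lambda>x. restrict (\<lambda>N. N #> x) \<N>"])
      have "(\<lambda>x. restrict (\<lambda>N. N #> x) \<N>) ` carrier G \<subseteq> (\<Pi>\<^sub>E N\<in>\<N>. rcosets N)"
        by (auto simp: RCOSETS_def)
      then show "finite ((\<lambda>x. restrict (\<lambda>N. N #> x) \<N>) ` carrier G)"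
        by (rule finite_subset) (use \<N> in \<open>auto intro!: finite_PiE\<close>)
      fix x y assume xy: "x \<in> carrier G" "y \<in> carrier G"
        "restrict (\<lambda>N. N #> x) \<N> = restrict (\<lambda>N. N #> y) \<N>"
      have "x \<otimes> inv y \<in> N" if "N \<in> \<N>" for N
      proof -
        have "N #> x = N #> y" using fun_cong[OF xy(3), of N] that by simp
        then show ?thesis using rcos_eq_iff[of N x y] \<N>(3)[OF that] xy by (auto dest: normal_imp_subgroup)
      qed
      then show "x \<otimes> inv y \<in> \<Inter>\<N>" by blast
    qed
  qed
qed

lemma (in normal) quotient_hom: "group_hom G (G Mod H) ((#>) H)"
  by (intro group_hom.intro group_hom_axioms.intro is_group factorgroup_is_group r_coset_hom_Mod)

lemma (in group) quotient_of_quotient_hom: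
  assumes N: "N \<lhd> G" and K: "K \<lhd> G" and NK: "N \<subseteq> K"
  shows "group_hom (G Mod N) (G Mod K) ((<#>) K)"
    and "(<#>) K ` carrier (G Mod N) = carrier (G Mod K)"
proof -
  interpret N: normal N G by (rule N)
  interpret K: normal K G by (rule K)
  have KN: "K <#> N = K"
  proof (rule equalityI)
    show "K <#> N \<subseteq> K" using NK by (auto simp: set_mult_def)
    show "K \<subseteq> K <#> N"
    proof
      fix k assume k: "k \<in> K"
      then have "k \<otimes> \<one> \<in> K <#> N" unfolding set_mult_def using N.one_closed by blast
      then show "k \<in> K <#> N" using k K.mem_carrier by simp
    qed
  qed
  have ev: "K <#> (N #> x) = K #> x" if "x \<in> carrier G" for x
    using setmult_rcos_assoc[OF K.subset N.subset that] KN by simp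
  show "(<#>) K ` carrier (G Mod N) = carrier (G Mod K)"
    by (auto simp: carrier_FactGroup image_image ev)
  have "(<#>) K \<in> hom (G Mod N) (G Mod K)"
    by (rule homI) (auto simp: carrier_FactGroup ev N.rcos_sum K.rcos_sum)
  then show "group_hom (G Mod N) (G Mod K) ((<#>) K)"
    by (intro group_hom.intro group_hom_axioms.intro N.factorgroup_is_group K.factorgroup_is_group)
qed

subsection \<open>Cocycles on a finite quotient\<close>

text \<open>The right cosets of the subgroup generated by \<open>x\<close> are the cycles of left
  translation by \<open>x\<close>; \<open>R\<close> takes one point from each.\<close>

lemma (in group) cyclic_translation_representatives:
  assumes fin: "finite (carrier G)" and x: "x \<in> carrier G"
  obtains R where "R \<subseteq> carrier G" "card R * ord x = order G"
    "\<And>v. v \<in> carrier G \<Longrightarrow> \<exists>u\<in>R. \<exists>j::nat. v = x [^] j \<otimes> u"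
proof -
  define U where "U = generate G {x}"
  have sub: "subgroup U G" unfolding U_def using x by (intro generate_is_subgroup) auto
  have "\<exists>u. u \<in> carrier G \<and> c = U #> u" if "c \<in> rcosets U" for c
    using that by (auto simp: RCOSETS_def)
  then obtain \<rho> where \<rho>: "\<And>c. c \<in> rcosets U \<Longrightarrow> \<rho> c \<in> carrier G \<and> c = U #> \<rho> c" by metis
  show thesis
  proof (rule that[of "\<rho> ` (rcosets U)"])
    show "\<rho> ` (rcosets U) \<subseteq> carrier G" using \<rho> by auto
    have "inj_on \<rho> (rcosets U)" using \<rho> by (metis inj_onI)
    then show "card (\<rho> ` (rcosets U)) * ord x = order G"
      using lagrange[OF sub] generate_pow_card[OF x] by (simp add: card_image U_def)
    fix v assume v: "v \<in> carrier G"
    have c: "U #> v \<in> rcosets U" using v subgroup.subset[OF sub] by (intro rcosetsI) auto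
    have "v \<in> U #> \<rho> (U #> v)" using rcos_self[OF v sub] \<rho>[OF c] by simp
    then obtain h where h: "h \<in> U" "v = h \<otimes> \<rho> (U #> v)" by (auto simp: r_coset_def)
    have "ord x \<noteq> 0" using ord_ge_1[OF fin x] by simp
    then have "U = {x [^] j | j. j \<in> (UNIV :: nat set)}" unfolding U_def by (rule generate_pow_nat[OF x])
    then show "\<exists>u\<in>\<rho> ` (rcosets U). \<exists>j::nat. v = x [^] j \<otimes> u" using h c by blast
  qed
qed

text \<open>\<open>Q\<close> is a finite quotient of \<open>F\<close> in which the relators die.
  Freeness of \<open>F\<close> enters through \<open>\<Phi>\<close>, which integrates every edge
  function.\<close>

locale weighted_quotient = group_hom F Q \<pi> for F (structure) and Q (structure) and \<pi> +
  fixes X :: "'a set" and \<Phi> :: "('a \<Rightarrow> 'a \<Rightarrow> int) \<Rightarrow> 'a \<Rightarrow> int"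
    and p :: nat and I :: "nat set" and r :: "nat \<Rightarrow> 'a" and n :: "nat \<Rightarrow> nat"
  assumes X: "X \<subseteq> carrier F" "generate F X = carrier F"
    and finX: "finite X"
    and potential: "\<And>y g s. g \<in> carrier F \<Longrightarrow> s \<in> X \<Longrightarrow> \<Phi> y (s \<otimes> g) = \<Phi> y g + y g s"
    and potential_linear: "\<And>y y' k g. \<Phi> (\<lambda>g s. y g s + k * y' g s) g = \<Phi> y g + k * \<Phi> y' g"
    and finite_Q: "finite (carrier Q)" and surj: "\<pi> ` carrier F = carrier Q"
    and prime_p: "prime p"
    and r: "\<And>i. i \<in> I \<Longrightarrow> r i \<in> carrier F"
    and relators: "\<And>i. i \<in> I \<Longrightarrow> \<pi> (r i) [^]\<^bsub>Q\<^esub> (p ^ n i) = \<one>\<^bsub>Q\<^esub>"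
    and weights: "\<And>A. A \<subseteq> I \<Longrightarrow> finite A \<Longrightarrow> (\<Sum>i\<in>A. 1 / real (p ^ n i)) \<le> 1 / 2"
begin

text \<open>\<open>z\<close> lives on the edges of the Cayley graph of \<open>Q\<close>; it is
  pulled back to \<open>F\<close> and integrated there.\<close>

definition pot :: "('c \<times> 'a \<Rightarrow> int) \<Rightarrow> 'a \<Rightarrow> int" where
  "pot z g = \<Phi> (\<lambda>g s. z (\<pi> g, s)) g"

definition relator :: "nat \<Rightarrow> 'a" where
  "relator i = r i [^] (p ^ n i)"

text \<open>The difference is the sum of \<open>z\<close> along the loop that the relator traces in
  \<open>Q\<close> from the vertex \<open>\<pi> g\<close>.\<close>

definition cocycles :: "('c \<times> 'a \<Rightarrow> int) set" where
  "cocycles = {z. \<forall>i\<in>I. \<forall>g\<in>carrier F. int p dvd pot z (relator i \<otimes> g) - pot z g}"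

lemma pot_step: "g \<in> carrier F \<Longrightarrow> s \<in> X \<Longrightarrow> pot z (s \<otimes> g) = pot z g + z (\<pi> g, s)"
  by (simp add: pot_def potential)

lemma pot_linear: "pot (\<lambda>e. z e + k * z' e) g = pot z g + k * pot z' g"
  by (simp add: pot_def potential_linear)

lemma pot_unique:
  assumes "\<And>s g. s \<in> X \<Longrightarrow> g \<in> carrier F \<Longrightarrow> f (s \<otimes> g) = f g + z (\<pi> g, s)"
    and "x \<in> carrier F" "g \<in> carrier F"
  shows "pot z (x \<otimes> g) - pot z g = f (x \<otimes> g) - f g"
proof -
  have "0 dvd (\<lambda>g. pot z g - f g) (x \<otimes> g) - (\<lambda>g. pot z g - f g) g"
    by (rule G.generate_increment_induct[OF X]) (use assms pot_step in auto)
  then show ?thesis by simp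
qed

text \<open>The pullback of \<open>z\<close> is invariant under right translation by the kernel of
  \<open>\<pi>\<close>. So the translated potential has the same differential, and increments depend
  only on the vertex \<open>\<pi> g\<close>.\<close>

lemma pot_increment_cong:
  assumes x: "x \<in> carrier F" and g: "g \<in> carrier F" "g' \<in> carrier F" "\<pi> g = \<pi> g'"
  shows "pot z (x \<otimes> g) - pot z g = pot z (x \<otimes> g') - pot z g'"
proof -
  define h where "h = inv g \<otimes> g'"
  have h: "h \<in> carrier F" "\<pi> h = \<one>\<^bsub>Q\<^esub>" "g \<otimes> h = g'"
    using g by (simp_all add: h_def flip: G.m_assoc)
  have "pot z (x \<otimes> g) - pot z g = pot z (x \<otimes> g \<otimes> h) - pot z (g \<otimes> h)"
  proof (rule pot_unique[of "\<lambda>g. pot z (g \<otimes> h)"])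
    fix s g assume sg: "s \<in> X" "g \<in> carrier F"
    then have "pot z (s \<otimes> (g \<otimes> h)) = pot z (g \<otimes> h) + z (\<pi> (g \<otimes> h), s)" using h by (intro pot_step) auto
    then show "pot z (s \<otimes> g \<otimes> h) = pot z (g \<otimes> h) + z (\<pi> g, s)" using sg h X by (auto simp: G.m_assoc)
  qed (use x g in auto)
  then show ?thesis using h x g by (simp add: G.m_assoc)
qed

lemma pot_increment_pow:
  assumes x: "x \<in> carrier F" "\<pi> x = \<one>\<^bsub>Q\<^esub>" and g: "g \<in> carrier F"
  shows "pot z (x [^] (j::nat) \<otimes> g) - pot z g = int j * (pot z (x \<otimes> g) - pot z g)"
proof (induction j)
  case 0
  then show ?case using g by simp
next
  case (Suc j)
  have "pot z (x \<otimes> (x [^] j \<otimes> g)) - pot z (x [^] j \<otimes> g) = pot z (x \<otimes> g) - pot z g"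
    using x g by (intro pot_increment_cong) (auto simp: hom_nat_pow)
  moreover have "x [^] Suc j \<otimes> g = x \<otimes> (x [^] j \<otimes> g)"
    using x g by (metis G.m_assoc G.nat_pow_Suc2 G.nat_pow_closed)
  ultimately show ?case using Suc by (simp add: algebra_simps)
qed

section \<open>The conditions imposed by the relators and their number\<close>

lemma relator_closed: "i \<in> I \<Longrightarrow> relator i \<in> carrier F"
  by (simp add: relator_def r)

lemma hom_relator: "i \<in> I \<Longrightarrow> \<pi> (relator i) = \<one>\<^bsub>Q\<^esub>"
  by (simp add: relator_def r hom_nat_pow relators)

text \<open>\<open>r i\<close> commutes with its own power. Hence the conditions at all vertices of
  one cycle of \<open>r i\<close> coincide, and one base point for each cycle is enough.\<close>

lemma relator_increment_shift:
  assumes i: "i \<in> I" and g: "g \<in> carrier F"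
  shows "pot z (relator i \<otimes> (r i [^] (j::nat) \<otimes> g)) - pot z (r i [^] j \<otimes> g)
    = pot z (relator i \<otimes> g) - pot z g"
proof -
  have "relator i \<otimes> r i [^] j = r i [^] j \<otimes> relator i"
    using r[OF i] by (simp add: relator_def G.nat_pow_mult add.commute)
  then have "relator i \<otimes> (r i [^] j \<otimes> g) = r i [^] j \<otimes> (relator i \<otimes> g)"
    using r[OF i] relator_closed[OF i] g by (metis G.m_assoc G.nat_pow_closed)
  moreover have "pot z (r i [^] j \<otimes> (relator i \<otimes> g)) - pot z (relator i \<otimes> g)
      = pot z (r i [^] j \<otimes> g) - pot z g"
    using r[OF i] relator_closed[OF i] hom_relator[OF i] g by (intro pot_increment_cong) auto
  ultimately show ?thesis by simp
qed

text \<open>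
  If the order \<open>d\<close> of \<open>r i\<close> in \<open>Q\<close> is a proper divisor of \<open>p ^ n i\<close>, a multiple of \<open>p\<close> copies of
  the loop \<open>r i [^] d\<close> make up the relator, which then imposes no condition modulo \<open>p\<close>.
\<close>

lemma relator_increment_trivial:
  assumes i: "i \<in> I" and g: "g \<in> carrier F" and ord: "H.ord (\<pi> (r i)) \<noteq> p ^ n i"
  shows "int p dvd pot z (relator i \<otimes> g) - pot z g"
proof -
  define d where "d = H.ord (\<pi> (r i))"
  have "d dvd p ^ n i"
    unfolding d_def using r[OF i] relators[OF i] by (subst H.pow_eq_id[symmetric]) auto
  then obtain k where k: "k \<le> n i" "d = p ^ k" using prime_p by (auto simp: divides_primepow_nat)
  have kn: "k < n i" using k ord by (cases "k = n i") (auto simp: d_def)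
  define x where "x = r i [^] d"
  have x: "x \<in> carrier F" "\<pi> x = \<one>\<^bsub>Q\<^esub>" using r[OF i] by (simp_all add: x_def hom_nat_pow d_def)
  have "p ^ n i = d * p ^ (n i - k)" using kn k by (simp flip: power_add)
  then have "relator i = x [^] (p ^ (n i - k))"
    using r[OF i] by (simp add: relator_def x_def G.nat_pow_pow)
  then have "pot z (relator i \<otimes> g) - pot z g = int (p ^ (n i - k)) * (pot z (x \<otimes> g) - pot z g)"
    using pot_increment_pow[OF x g] by simp
  moreover have "int p dvd int (p ^ (n i - k))" using kn by (simp add: dvd_power)
  ultimately show ?thesis by simp
qed

definition active :: "nat set" where
  "active = {i \<in> I. H.ord (\<pi> (r i)) = p ^ n i}"

definition base_points :: "nat \<Rightarrow> 'c set" where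
  "base_points i = (SOME R. R \<subseteq> carrier Q \<and> card R * H.ord (\<pi> (r i)) = order Q \<and>
     (\<forall>v\<in>carrier Q. \<exists>u\<in>R. \<exists>j::nat. v = \<pi> (r i) [^]\<^bsub>Q\<^esub> j \<otimes>\<^bsub>Q\<^esub> u))"

lemma base_points:
  assumes "i \<in> I"
  shows "base_points i \<subseteq> carrier Q" "card (base_points i) * H.ord (\<pi> (r i)) = order Q"
    "\<And>v. v \<in> carrier Q \<Longrightarrow> \<exists>u\<in>base_points i. \<exists>j::nat. v = \<pi> (r i) [^]\<^bsub>Q\<^esub> j \<otimes>\<^bsub>Q\<^esub> u"
proof -
  have "\<pi> (r i) \<in> carrier Q" using r[OF assms] by simp
  then have "\<exists>R. R \<subseteq> carrier Q \<and> card R * H.ord (\<pi> (r i)) = order Q \<and>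
     (\<forall>v\<in>carrier Q. \<exists>u\<in>R. \<exists>j::nat. v = \<pi> (r i) [^]\<^bsub>Q\<^esub> j \<otimes>\<^bsub>Q\<^esub> u)"
    using H.cyclic_translation_representatives[OF finite_Q] by metis
  from someI_ex[OF this] show "base_points i \<subseteq> carrier Q" "card (base_points i) * H.ord (\<pi> (r i)) = order Q"
    "\<And>v. v \<in> carrier Q \<Longrightarrow> \<exists>u\<in>base_points i. \<exists>j::nat. v = \<pi> (r i) [^]\<^bsub>Q\<^esub> j \<otimes>\<^bsub>Q\<^esub> u"
    unfolding base_points_def by blast+
qed

definition lift :: "'c \<Rightarrow> 'a" where
  "lift v = (SOME g. g \<in> carrier F \<and> \<pi> g = v)"

lemma lift: "v \<in> carrier Q \<Longrightarrow> lift v \<in> carrier F" "v \<in> carrier Q \<Longrightarrow> \<pi> (lift v) = v"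
proof -
  assume "v \<in> carrier Q"
  then have "\<exists>g. g \<in> carrier F \<and> \<pi> g = v" using surj by (metis imageE)
  from someI_ex[OF this] show "lift v \<in> carrier F" "\<pi> (lift v) = v" unfolding lift_def by auto
qed

lemma order_pos: "order Q > 0"
  using finite_Q by (simp add: H.order_gt_0_iff_finite)

lemma active_base_points: "i \<in> active \<Longrightarrow> real (card (base_points i)) = real (order Q) * (1 / real (p ^ n i))"
proof -
  assume "i \<in> active"
  then have "card (base_points i) * p ^ n i = order Q" using base_points(2)[of i] by (auto simp: active_def)
  then have "real (card (base_points i)) * real (p ^ n i) = real (order Q)" by (metis of_nat_mult)
  then show ?thesis using prime_gt_0_nat[OF prime_p] by (simp add: field_simps)
qed

text \<open>The order of an active \<open>r i\<close> is at most \<open>order Q\<close>, so its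
  weight is at least \<open>1 / order Q\<close>; \<open>order Q\<close> such relators would exceed
  the total weight \<open>1 / 2\<close>.\<close>

lemma finite_active: "finite active"
proof (rule ccontr)
  assume "infinite active"
  then obtain A where A: "finite A" "card A = order Q" "A \<subseteq> active"
    using infinite_arbitrarily_large by blast
  have "1 / real (order Q) \<le> 1 / real (p ^ n i)" if "i \<in> active" for i
  proof -
    have "p ^ n i \<le> order Q"
      using base_points(2)[of i] order_pos that unfolding active_def
      by (metis (mono_tags, lifting) dvd_imp_le dvd_triv_right mem_Collect_eq)
    then show ?thesis
      using prime_gt_0_nat[OF prime_p] order_pos
      by (intro divide_left_mono mult_pos_pos) (auto simp flip: of_nat_power)
  qed
  then have "(\<Sum>i\<in>A. 1 / real (order Q)) \<le> (\<Sum>i\<in>A. 1 / real (p ^ n i))"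
    using A by (intro sum_mono) auto
  also have "\<dots> \<le> 1 / 2" using A by (intro weights) (auto simp: active_def)
  finally show False using A order_pos by simp
qed

definition constraints :: "(nat \<times> 'c) set" where
  "constraints = Sigma active base_points"

definition constraint :: "('c \<times> 'a \<Rightarrow> int) \<Rightarrow> nat \<times> 'c \<Rightarrow> int" where
  "constraint z c = pot z (relator (fst c) \<otimes> lift (snd c)) - pot z (lift (snd c))"

lemma finite_constraints: "finite constraints"
proof -
  have "finite (base_points i)" if "i \<in> active" for i
    using base_points(1)[of i] that finite_Q by (auto simp: active_def intro: finite_subset)
  then show ?thesis using finite_active by (simp add: constraints_def)
qed

text \<open>An active relator has \<open>order Q / p ^ n i\<close> cycles; the bound on the weights
  does the rest.\<close>

lemma card_constraints: "2 * card constraints \<le> order Q"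
proof -
  have "finite (base_points i)" if "i \<in> active" for i
    using base_points(1)[of i] that finite_Q by (auto simp: active_def intro: finite_subset)
  then have "card constraints = (\<Sum>i\<in>active. card (base_points i))"
    unfolding constraints_def using finite_active by (intro card_SigmaI) auto
  then have "real (card constraints) = (\<Sum>i\<in>active. real (order Q) * (1 / real (p ^ n i)))"
    using active_base_points by simp
  also have "\<dots> = real (order Q) * (\<Sum>i\<in>active. 1 / real (p ^ n i))" by (simp add: sum_distrib_left)
  also have "\<dots> \<le> real (order Q) * (1 / 2)"
    using finite_active by (intro mult_left_mono weights) (auto simp: active_def)
  finally show ?thesis by simp
qed

sublocale sys: mod_system p "carrier Q \<times> X" constraints constraint
proof
  show "prime p" by (rule prime_p)
  show "finite (carrier Q \<times> X)" using finite_Q finX by simp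
  show "finite constraints" by (rule finite_constraints)
  show "constraint (\<lambda>e. z e + k * z' e) c = constraint z c + k * constraint z' c" for z z' k c
    by (simp add: constraint_def pot_linear algebra_simps)
qed

text \<open>Inactive relators hold automatically, and an active one can be moved along its cycle to
  a base point. So finitely many constraints describe all cocycles.\<close>

lemma sols_eq_cocycles: "sys.sols = cocycles"
proof (intro equalityI subsetI)
  fix z assume z: "z \<in> cocycles"
  have "int p dvd constraint z c" if "c \<in> constraints" for c
  proof -
    have "fst c \<in> I" "snd c \<in> carrier Q" using that base_points(1)[of "fst c"] by (auto simp: constraints_def active_def)
    then show ?thesis using z lift by (auto simp: constraint_def cocycles_def)
  qed
  then show "z \<in> sys.sols" by (simp add: sys.sols_def)
next
  fix z assume z: "z \<in> sys.sols"
  have "int p dvd pot z (relator i \<otimes> g) - pot z g" if i: "i \<in> I" and g: "g \<in> carrier F" for i g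
  proof (cases "i \<in> active")
    case False
    then show ?thesis using relator_increment_trivial[OF i g] i by (simp add: active_def)
  next
    case True
    obtain u and j :: nat where u: "u \<in> base_points i" "\<pi> g = \<pi> (r i) [^]\<^bsub>Q\<^esub> j \<otimes>\<^bsub>Q\<^esub> u"
      using base_points(3)[OF i, of "\<pi> g"] g by auto
    have lu: "lift u \<in> carrier F" "\<pi> (lift u) = u" using lift u base_points(1)[OF i] by auto
    have "pot z (relator i \<otimes> g) - pot z g
        = pot z (relator i \<otimes> (r i [^] j \<otimes> lift u)) - pot z (r i [^] j \<otimes> lift u)"
      using relator_closed[OF i] g r[OF i] lu u by (intro pot_increment_cong) (auto simp: hom_nat_pow)
    also have "\<dots> = constraint z (i, u)"
      using relator_increment_shift[OF i lu(1)] by (simp add: constraint_def)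
    finally have "pot z (relator i \<otimes> g) - pot z g = constraint z (i, u)" .
    moreover have "(i, u) \<in> constraints" using u True by (simp add: constraints_def)
    ultimately show ?thesis using z by (auto simp: sys.sols_def)
  qed
  then show "z \<in> cocycles" by (simp add: cocycles_def)
qed

section \<open>Coboundaries and the edges labelled \<open>a\<close>\<close>

lemma coboundary_cocycle:
  "(\<lambda>e. f (\<pi> (snd e) \<otimes>\<^bsub>Q\<^esub> fst e) - f (fst e)) \<in> cocycles"
proof -
  \<comment> \<open>The composition of \<open>f\<close> with \<open>\<pi>\<close> has this
    differential, and a relator does not move \<open>\<pi> g\<close>.\<close>
  have "pot (\<lambda>e. f (\<pi> (snd e) \<otimes>\<^bsub>Q\<^esub> fst e) - f (fst e)) (relator i \<otimes> g)
      - pot (\<lambda>e. f (\<pi> (snd e) \<otimes>\<^bsub>Q\<^esub> fst e) - f (fst e)) g = 0"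
    if "i \<in> I" "g \<in> carrier F" for i g
    using pot_unique[of "\<lambda>g. f (\<pi> g)" "\<lambda>e. f (\<pi> (snd e) \<otimes>\<^bsub>Q\<^esub> fst e) - f (fst e)" "relator i" g]
      relator_closed hom_relator that X by (auto simp: subset_iff)
  then show ?thesis by (simp add: cocycles_def)
qed

text \<open>Removing the edges at which \<open>\<kappa>\<close> wraps around cuts the cycles of
  \<open>a\<close> into paths, and on a disjoint union of paths every function is a
  differential.\<close>

lemma independent_long_cycles:
  assumes a: "a \<in> X"
    and \<kappa>: "\<And>v. v \<in> carrier Q \<Longrightarrow> \<kappa> (\<pi> a \<otimes>\<^bsub>Q\<^esub> v) = Suc (\<kappa> v) mod m"
  shows "sys.independent ({v \<in> carrier Q. Suc (\<kappa> v) < m} \<times> {a})"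
  unfolding sys.independent_def sols_eq_cocycles
proof
  fix y :: "'c \<times> 'a \<Rightarrow> int"
  define \<alpha> where "\<alpha> = \<pi> a"
  have \<alpha>: "\<alpha> \<in> carrier Q" using a X by (auto simp: \<alpha>_def)
  \<comment> \<open>The sum of \<open>y\<close> along the path of \<open>a\<close>-edges leading to
    \<open>v\<close> from the point where \<open>\<kappa>\<close> is \<open>0\<close>.\<close>
  define f where "f v = (\<Sum>j<\<kappa> v. y (inv\<^bsub>Q\<^esub> \<alpha> [^]\<^bsub>Q\<^esub> Suc j \<otimes>\<^bsub>Q\<^esub> v, a))" for v
  have "f (\<alpha> \<otimes>\<^bsub>Q\<^esub> v) - f v = y (v, a)" if v: "v \<in> carrier Q" "Suc (\<kappa> v) < m" for v
  proof -
    have *: "inv\<^bsub>Q\<^esub> \<alpha> [^]\<^bsub>Q\<^esub> Suc j \<otimes>\<^bsub>Q\<^esub> (\<alpha> \<otimes>\<^bsub>Q\<^esub> v) = inv\<^bsub>Q\<^esub> \<alpha> [^]\<^bsub>Q\<^esub> j \<otimes>\<^bsub>Q\<^esub> v" for j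
      using \<alpha> v by (simp add: H.m_assoc flip: H.m_assoc[of "inv\<^bsub>Q\<^esub> \<alpha>" \<alpha> v])
    have "f (\<alpha> \<otimes>\<^bsub>Q\<^esub> v) = (\<Sum>j<Suc (\<kappa> v). y (inv\<^bsub>Q\<^esub> \<alpha> [^]\<^bsub>Q\<^esub> j \<otimes>\<^bsub>Q\<^esub> v, a))"
      using \<kappa>[OF v(1)] v(2) unfolding f_def * by (simp add: \<alpha>_def)
    also have "\<dots> = y (v, a) + f v"
      unfolding f_def sum.lessThan_Suc_shift using v by simp
    finally show ?thesis by simp
  qed
  then show "\<exists>z\<in>cocycles. \<forall>e\<in>{v \<in> carrier Q. Suc (\<kappa> v) < m} \<times> {a}. [z e = y e] (mod int p)"
    using coboundary_cocycle[of f] by (intro bexI[of _ "\<lambda>e. f (\<pi> (snd e) \<otimes>\<^bsub>Q\<^esub> fst e) - f (fst e)"]) (auto simp: \<alpha>_def)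
qed

text \<open>The translates of \<open>T\<close> by the first \<open>m\<close> powers of
  \<open>\<alpha>\<close> carry different labels \<open>\<kappa>\<close>, so they are disjoint, and
  \<open>T\<close> has at most \<open>order Q / m\<close> points.\<close>

lemma card_long_cycles:
  assumes a: "a \<in> X" and m: "m > 0"
    and lt: "\<And>v. v \<in> carrier Q \<Longrightarrow> \<kappa> v < m"
    and \<kappa>: "\<And>v. v \<in> carrier Q \<Longrightarrow> \<kappa> (\<pi> a \<otimes>\<^bsub>Q\<^esub> v) = Suc (\<kappa> v) mod m"
  shows "m * card {v \<in> carrier Q. Suc (\<kappa> v) < m} \<ge> (m - 1) * order Q"
proof -
  define \<alpha> where "\<alpha> = \<pi> a"
  have \<alpha>: "\<alpha> \<in> carrier Q" using a X by (auto simp: \<alpha>_def)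
  define T where "T = {v \<in> carrier Q. Suc (\<kappa> v) = m}"
  have pow: "\<kappa> (\<alpha> [^]\<^bsub>Q\<^esub> j \<otimes>\<^bsub>Q\<^esub> v) = (\<kappa> v + j) mod m" if "v \<in> carrier Q" for v and j :: nat
  proof (induction j)
    case 0
    then show ?case using lt[OF that] that by simp
  next
    case (Suc j)
    have "\<alpha> [^]\<^bsub>Q\<^esub> Suc j \<otimes>\<^bsub>Q\<^esub> v = \<alpha> \<otimes>\<^bsub>Q\<^esub> (\<alpha> [^]\<^bsub>Q\<^esub> j \<otimes>\<^bsub>Q\<^esub> v)"
      using \<alpha> that by (metis H.m_assoc H.nat_pow_Suc2 H.nat_pow_closed)
    then show ?case using \<kappa>[of "\<alpha> [^]\<^bsub>Q\<^esub> j \<otimes>\<^bsub>Q\<^esub> v"] Suc \<alpha> that by (simp add: \<alpha>_def mod_Suc_eq)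
  qed
  have "card ({..<m} \<times> T) \<le> card (carrier Q)"
  proof (rule card_inj_on_le[of "\<lambda>(j, v). \<alpha> [^]\<^bsub>Q\<^esub> j \<otimes>\<^bsub>Q\<^esub> v"])
    show "inj_on (\<lambda>(j, v). \<alpha> [^]\<^bsub>Q\<^esub> j \<otimes>\<^bsub>Q\<^esub> v) ({..<m} \<times> T)"
    proof (rule inj_onI, clarsimp)
      fix j j' v v' assume h: "j < m" "j' < m" "v \<in> T" "v' \<in> T"
        "\<alpha> [^]\<^bsub>Q\<^esub> j \<otimes>\<^bsub>Q\<^esub> v = \<alpha> [^]\<^bsub>Q\<^esub> j' \<otimes>\<^bsub>Q\<^esub> v'"
      have "\<kappa> v = m - 1" "\<kappa> v' = m - 1" using h by (auto simp: T_def)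
      then have "(m - 1 + j) mod m = (m - 1 + j') mod m"
        using pow[of v j] pow[of v' j'] h by (simp add: T_def)
      then have "j = j'" using h(1,2) by (metis cong_def cong_add_lcancel_nat cong_less_modulus_unique_nat)
      moreover have "v = v'" using h \<open>j = j'\<close> \<alpha> by (simp add: T_def)
      ultimately show "j = j' \<and> v = v'" by simp
    qed
    show "(\<lambda>(j, v). \<alpha> [^]\<^bsub>Q\<^esub> j \<otimes>\<^bsub>Q\<^esub> v) ` ({..<m} \<times> T) \<subseteq> carrier Q" using \<alpha> by (auto simp: T_def)
  qed (rule finite_Q)
  then have mT: "m * card T \<le> order Q" by (simp add: card_cartesian_product order_def)
  have "{v \<in> carrier Q. Suc (\<kappa> v) < m} = carrier Q - T" using lt by (fastforce simp: T_def)
  then have "card {v \<in> carrier Q. Suc (\<kappa> v) < m} = order Q - card T"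
    using finite_Q by (simp add: card_Diff_subset T_def order_def)
  then show ?thesis using mT by (simp add: algebra_simps diff_mult_distrib2)
qed

text \<open>
  Every \<open>z\<close> restricts on the translate of \<open>T\<close> by \<open>v\<close> to the differential of a function on the
  vertices of \<open>T\<close>, so an independent set meets that translate in at most as many edges as \<open>T\<close> has
  vertices; the inequality is the sum over all \<open>v\<close>.
\<close>

lemma sum_independent_le:
  assumes J: "J \<subseteq> carrier Q \<times> X" "sys.independent J"
    and T: "finite T" "T \<subseteq> carrier F \<times> X" and inj: "inj_on (\<lambda>(x, s). (\<pi> x, s)) T"
    and \<theta>: "\<And>z x y g. z \<in> cocycles \<Longrightarrow> x \<in> carrier F \<Longrightarrow> y \<in> carrier F \<Longrightarrow> g \<in> carrier F
        \<Longrightarrow> \<theta> x = \<theta> y \<Longrightarrow> [pot z (x \<otimes> g) = pot z (y \<otimes> g)] (mod int p)"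
  shows "(\<Sum>t\<in>T. card {v. (v, snd t) \<in> J}) \<le> order Q * card (\<theta> ` (fst ` T \<union> (\<lambda>(x, s). s \<otimes> x) ` T))"
proof -
  define W where "W = fst ` T \<union> (\<lambda>(x, s). s \<otimes> x) ` T"
  have WF: "W \<subseteq> carrier F" using T X by (auto simp: W_def)
  have finW: "finite W" using T by (simp add: W_def)
  \<comment> \<open>One representative in \<open>W\<close> for each class of
    \<open>\<theta>\<close>; the class alone determines the potential of a cocycle modulo
    \<open>p\<close>.\<close>
  define lo where "lo \<beta> = inv_into W \<theta> \<beta>" for \<beta>
  have lo: "lo (\<theta> x) \<in> carrier F" "\<theta> (lo (\<theta> x)) = \<theta> x" if "x \<in> W" for x
    using that WF inv_into_into[of "\<theta> x" \<theta> W] f_inv_into_f[of "\<theta> x" \<theta> W] by (auto simp: lo_def)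
  \<comment> \<open>Right translation by \<open>v\<close> is an automorphism of the Cayley graph of
    \<open>Q\<close>; \<open>E v\<close> is its effect on the images of the edges of
    \<open>T\<close>.\<close>
  define E :: "'c \<Rightarrow> 'a \<times> 'a \<Rightarrow> 'c \<times> 'a" where "E v = (\<lambda>(x, s). (\<pi> x \<otimes>\<^bsub>Q\<^esub> v, s))" for v
  have fin: "finite {v. (v, s) \<in> J}" for s
    by (rule finite_subset[OF _ finite_Q]) (use J in auto)
  have bound: "card {t \<in> T. E v t \<in> J} \<le> card (\<theta> ` W)" if v: "v \<in> carrier Q" for v
  proof -
    define S where "S = E v ` {t \<in> T. E v t \<in> J}"
    have "inj_on (E v) T"
    proof (rule inj_onI)
      fix t t' assume tt: "t \<in> T" "t' \<in> T" "E v t = E v t'"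
      have "fst t \<in> carrier F" "fst t' \<in> carrier F" using tt T by auto
      then have "\<pi> (fst t) = \<pi> (fst t')" "snd t = snd t'" using tt v by (auto simp: E_def split_beta)
      then show "t = t'" using inj_onD[OF inj _ tt(1,2)] by (simp add: split_beta)
    qed
    then have "card {t \<in> T. E v t \<in> J} = card S"
      unfolding S_def by (intro card_image[symmetric]) (auto intro: inj_on_subset)
    also have "\<dots> \<le> card (\<theta> ` W)"
    proof (rule sys.card_independent_le[where \<Theta> = "\<lambda>z \<beta>. pot z (lo \<beta> \<otimes> lift v)"])
      show "sys.independent S" by (rule sys.independent_mono[OF J(2)]) (auto simp: S_def)
      show "finite S" using T by (simp add: S_def)
      show "finite (\<theta> ` W)" using finW by simp
      fix z z' e assume z: "z \<in> sys.sols" "z' \<in> sys.sols" and e: "e \<in> S"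
        and eq: "\<And>\<beta>. \<beta> \<in> \<theta> ` W \<Longrightarrow> [pot z (lo \<beta> \<otimes> lift v) = pot z' (lo \<beta> \<otimes> lift v)] (mod int p)"
      have agree: "[pot z (x \<otimes> lift v) = pot z' (x \<otimes> lift v)] (mod int p)" if x: "x \<in> W" for x
      proof -
        have "[pot z (x \<otimes> lift v) = pot z (lo (\<theta> x) \<otimes> lift v)] (mod int p)"
          using \<theta>[of z x "lo (\<theta> x)" "lift v"] z(1) x WF lo[OF x] lift[OF v] by (auto simp: sols_eq_cocycles)
        moreover have "[pot z' (lo (\<theta> x) \<otimes> lift v) = pot z' (x \<otimes> lift v)] (mod int p)"
          using \<theta>[of z' "lo (\<theta> x)" x "lift v"] z(2) x WF lo[OF x] lift[OF v] by (auto simp: sols_eq_cocycles)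
        ultimately show ?thesis using eq[of "\<theta> x"] x by (meson cong_trans imageI)
      qed
      obtain x s where xs: "(x, s) \<in> T" "e = (\<pi> x \<otimes>\<^bsub>Q\<^esub> v, s)" using e by (auto simp: S_def E_def)
      have x: "x \<in> carrier F" "s \<in> X" using xs T by auto
      have W: "x \<in> W" "s \<otimes> x \<in> W" using xs by (force simp: W_def)+
      have val: "w e = pot w (s \<otimes> x \<otimes> lift v) - pot w (x \<otimes> lift v)" for w
        using pot_step[of "x \<otimes> lift v" s w] x X lift[OF v] xs(2) by (auto simp: G.m_assoc)
      show "[z e = z' e] (mod int p)"
        unfolding val using agree[OF W(1)] agree[OF W(2)] by (rule cong_diff[rotated])
    qed
    finally show ?thesis .
  qed
  \<comment> \<open>Double counting: as \<open>v\<close> varies, the translates of a fixed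
    \<open>t\<close> run exactly once through the edges with its label.\<close>
  have "(\<Sum>t\<in>T. card {v. (v, snd t) \<in> J}) = (\<Sum>t\<in>T. card {v \<in> carrier Q. E v t \<in> J})"
  proof (rule sum.cong[OF refl])
    fix t assume t: "t \<in> T"
    have x: "\<pi> (fst t) \<in> carrier Q" using t T by auto
    have "bij_betw (\<lambda>v. \<pi> (fst t) \<otimes>\<^bsub>Q\<^esub> v) {v \<in> carrier Q. E v t \<in> J} {v. (v, snd t) \<in> J}"
    proof (rule bij_betwI[where g = "\<lambda>v. inv\<^bsub>Q\<^esub> \<pi> (fst t) \<otimes>\<^bsub>Q\<^esub> v"])
      show "(\<lambda>v. \<pi> (fst t) \<otimes>\<^bsub>Q\<^esub> v) \<in> {v \<in> carrier Q. E v t \<in> J} \<rightarrow> {v. (v, snd t) \<in> J}"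
        by (auto simp: E_def split_beta)
      show "(\<lambda>v. inv\<^bsub>Q\<^esub> \<pi> (fst t) \<otimes>\<^bsub>Q\<^esub> v) \<in> {v. (v, snd t) \<in> J} \<rightarrow> {v \<in> carrier Q. E v t \<in> J}"
        using x J by (auto simp: E_def split_beta simp flip: H.m_assoc)
    qed (use x J in \<open>auto simp flip: H.m_assoc\<close>)
    then show "card {v. (v, snd t) \<in> J} = card {v \<in> carrier Q. E v t \<in> J}" by (simp add: bij_betw_same_card)
  qed
  also have "\<dots> = (\<Sum>v\<in>carrier Q. card {t \<in> T. E v t \<in> J})"
    using sum_multicount_gen[OF T(1) finite_Q, of "\<lambda>t v. E v t \<in> J" "\<lambda>v. card {t \<in> T. E v t \<in> J}"] by simp
  also have "\<dots> \<le> (\<Sum>v\<in>carrier Q. card (\<theta> ` W))" using bound by (intro sum_mono) auto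
  finally show ?thesis by (simp add: W_def order_def)
qed

text \<open>\<open>J\<close> has at least \<open>5N/2\<close> edges, at most \<open>N\<close> of
  them labelled \<open>a\<close>, whence \<open>N \<le> j b + j c\<close>; and \<open>j a\<close> is
  at least \<open>(1 - 1/m) N\<close>. Through \<open>sum_independent_le\<close> this gives the
  claim up to an error \<open>card A / m < 1\<close>, which integrality removes.\<close>

lemma expanding:
  assumes X_eq: "X = {a, b, c}" and abc: "distinct [a, b, c]"
    and lt: "\<And>v. v \<in> carrier Q \<Longrightarrow> \<kappa> v < m"
    and \<kappa>: "\<And>v. v \<in> carrier Q \<Longrightarrow> \<kappa> (\<pi> a \<otimes>\<^bsub>Q\<^esub> v) = Suc (\<kappa> v) mod m"
    and A: "A \<subseteq> carrier F" "finite A" "inj_on \<pi> A" "card A < m"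
    and B: "B \<subseteq> carrier F" "finite B" "inj_on \<pi> B"
    and \<theta>: "\<And>z x y g. z \<in> cocycles \<Longrightarrow> x \<in> carrier F \<Longrightarrow> y \<in> carrier F \<Longrightarrow> g \<in> carrier F
        \<Longrightarrow> \<theta> x = \<theta> y \<Longrightarrow> [pot z (x \<otimes> g) = pot z (y \<otimes> g)] (mod int p)"
  shows "card A + card B \<le> card (\<theta> ` (A \<union> (\<otimes>) a ` A \<union> (B \<union> (\<otimes>) b ` B \<union> (\<otimes>) c ` B)))"
    (is "_ \<le> card (\<theta> ` ?W)")
proof -
  define N where "N = order Q"
  have a: "a \<in> X" using X_eq by simp
  define S where "S = {v \<in> carrier Q. Suc (\<kappa> v) < m} \<times> {a}"
  have "S \<subseteq> carrier Q \<times> X" using a by (auto simp: S_def)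
  moreover have "sys.independent S" unfolding S_def using a \<kappa> by (rule independent_long_cycles)
  ultimately obtain J where J: "S \<subseteq> J" "J \<subseteq> carrier Q \<times> X" "sys.independent J"
    and span: "\<And>z e. z \<in> sys.sols \<Longrightarrow> (\<And>e. e \<in> J \<Longrightarrow> int p dvd z e) \<Longrightarrow> e \<in> carrier Q \<times> X \<Longrightarrow> int p dvd z e"
    by (rule sys.extend_to_spanning) blast
  have finJ: "finite J" using J(2) finite_Q finX finite_subset by blast
  define j where "j s = card {v. (v, s) \<in> J}" for s
  have fin: "finite {v. (v, s) \<in> J}" for s
    by (rule finite_subset[OF _ finite_Q]) (use J in auto)
  have cX: "card X = 3" using abc by (simp add: X_eq)
  have "card J = (\<Sum>s\<in>X. j s)"
  proof -
    have "bij_betw prod.swap (SIGMA s:X. {v. (v, s) \<in> J}) J"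
      by (rule bij_betwI[where g = prod.swap]) (use J(2) in auto)
    then have "card J = card (SIGMA s:X. {v. (v, s) \<in> J})" by (simp add: bij_betw_same_card)
    then show ?thesis using fin finX by (simp add: j_def)
  qed
  then have cJ: "card J = j a + (j b + j c)" using abc by (simp add: X_eq)
  have "card (carrier Q \<times> X) \<le> card J + card constraints"
    using J(2) span by (rule sys.card_le_spanning)
  then have "3 * N \<le> card J + card constraints"
    using cX by (simp add: card_cartesian_product N_def order_def)
  then have J3: "6 * N \<le> 2 * (j a + (j b + j c)) + N" using card_constraints cJ by (simp add: N_def)
  have ja: "j a \<le> N" unfolding j_def N_def order_def by (rule card_mono[OF finite_Q]) (use J in auto)
  have bc: "N \<le> j b + j c" using J3 ja by arith
  have "card {v \<in> carrier Q. Suc (\<kappa> v) < m} \<le> j a"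
    unfolding j_def using J(1) by (intro card_mono fin) (auto simp: S_def)
  moreover have "(m - 1) * N \<le> m * card {v \<in> carrier Q. Suc (\<kappa> v) < m}"
    unfolding N_def using A(4) by (intro card_long_cycles[where a = a and \<kappa> = \<kappa>] a lt \<kappa>) auto
  ultimately have mja: "(m - 1) * N \<le> m * j a" by (meson le_trans mult_le_mono2)
  define T where "T = A \<times> {a} \<union> B \<times> {b, c}"
  have "(\<Sum>t\<in>T. card {v. (v, snd t) \<in> J}) \<le> N * card (\<theta> ` (fst ` T \<union> (\<lambda>(x, s). s \<otimes> x) ` T))"
    unfolding N_def
  proof (rule sum_independent_le[OF J(2,3)])
    show "finite T" using A B by (simp add: T_def)
    show "T \<subseteq> carrier F \<times> X" using A B by (auto simp: T_def X_eq)
    show "inj_on (\<lambda>(x, s). (\<pi> x, s)) T"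
      using A(3) B(3) abc by (auto simp: T_def inj_on_def)
  qed (rule \<theta>)
  also have "\<dots> \<le> N * card (\<theta> ` ?W)"
    using A B by (intro mult_le_mono2 card_mono image_mono) (auto simp: T_def)
  also have "(\<Sum>t\<in>T. card {v. (v, snd t) \<in> J}) = card A * j a + card B * (j b + j c)"
  proof -
    have "(\<Sum>t\<in>T. card {v. (v, snd t) \<in> J})
        = (\<Sum>t\<in>A \<times> {a}. card {v. (v, snd t) \<in> J}) + (\<Sum>t\<in>B \<times> {b, c}. card {v. (v, snd t) \<in> J})"
      unfolding T_def using A B abc by (intro sum.union_disjoint) auto
    also have "(\<Sum>t\<in>A \<times> {a}. card {v. (v, snd t) \<in> J}) = (\<Sum>x\<in>A. \<Sum>s\<in>{a}. j s)"
      by (subst sum.cartesian_product) (simp add: j_def split_beta)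
    also have "(\<Sum>t\<in>B \<times> {b, c}. card {v. (v, snd t) \<in> J}) = (\<Sum>x\<in>B. \<Sum>s\<in>{b, c}. j s)"
      by (subst sum.cartesian_product) (simp add: j_def split_beta)
    finally show ?thesis using abc by simp
  qed
  finally have key: "card A * j a + card B * (j b + j c) \<le> N * card (\<theta> ` ?W)" .
  show ?thesis
  proof (rule ccontr)
    assume "\<not> ?thesis"
    then have less: "Suc (card (\<theta> ` ?W)) \<le> card A + card B" by simp
    \<comment> \<open>All terms carry the factor \<open>m\<close> to avoid fractions. A failure of
      the claim by at least one would then give \<open>m \<le> card A\<close>.\<close>
    have "card A * ((m - 1) * N) + card B * (m * N) \<le> card A * (m * j a) + card B * (m * (j b + j c))"
      using mja bc by (intro add_mono mult_le_mono2)
    also have "\<dots> = m * (card A * j a + card B * (j b + j c))" by (simp add: algebra_simps)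
    also have "\<dots> \<le> m * (N * card (\<theta> ` ?W))" using key by (rule mult_le_mono2)
    finally have "(card A * (m - 1) + card B * m) * N \<le> (m * card (\<theta> ` ?W)) * N"
      by (simp add: algebra_simps)
    then have "card A * (m - 1) + card B * m \<le> m * card (\<theta> ` ?W)"
      using order_pos by (simp add: N_def)
    moreover have "m * Suc (card (\<theta> ` ?W)) \<le> m * (card A + card B)" using less by (rule mult_le_mono2)
    moreover have "card A * m = card A * (m - 1) + card A" using A(4) by (cases m) auto
    ultimately show False using A(4) by (simp add: algebra_simps)
  qed
qed

text \<open>
  The elements of \<open>F\<close> along which the potential of \<open>z\<close> is periodic modulo \<open>p\<close> form a normal
  subgroup of finite index containing the relators, hence containing \<open>profinite_kernel\<close>: this is
  why potentials descend to the quotient by it.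
\<close>

definition invariants :: "('c \<times> 'a \<Rightarrow> int) \<Rightarrow> 'a set" where
  "invariants z = {h \<in> carrier F. \<pi> h = \<one>\<^bsub>Q\<^esub> \<and> (\<forall>g\<in>carrier F. int p dvd pot z (h \<otimes> g) - pot z g)}"

lemma invariants_normal: "invariants z \<lhd> F"
proof (rule G.normal_invI)
  show "subgroup (invariants z) F"
  proof (rule G.subgroupI)
    show "invariants z \<subseteq> carrier F" by (auto simp: invariants_def)
    show "invariants z \<noteq> {}" by (auto simp: invariants_def intro!: exI[of _ \<one>])
    fix h assume h: "h \<in> invariants z"
    have "int p dvd pot z (inv h \<otimes> g) - pot z g" if g: "g \<in> carrier F" for g
    proof -
      have "int p dvd pot z (h \<otimes> (inv h \<otimes> g)) - pot z (inv h \<otimes> g)" using h g by (auto simp: invariants_def)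
      moreover have "h \<otimes> (inv h \<otimes> g) = g" using h g by (simp add: invariants_def flip: G.m_assoc)
      ultimately show ?thesis by (simp add: dvd_diff_commute)
    qed
    then show "inv h \<in> invariants z" using h by (simp add: invariants_def)
    fix h' assume h': "h' \<in> invariants z"
    have "int p dvd pot z (h \<otimes> h' \<otimes> g) - pot z g" if g: "g \<in> carrier F" for g
    proof -
      have "int p dvd (pot z (h \<otimes> (h' \<otimes> g)) - pot z (h' \<otimes> g)) + (pot z (h' \<otimes> g) - pot z g)"
        using h h' g by (intro dvd_add) (auto simp: invariants_def)
      then show ?thesis using h h' g by (simp add: G.m_assoc invariants_def)
    qed
    then show "h \<otimes> h' \<in> invariants z" using h h' by (simp add: invariants_def)
  qed
next
  fix x h assume x: "x \<in> carrier F" and h: "h \<in> invariants z"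
  have hF: "h \<in> carrier F" "\<pi> h = \<one>\<^bsub>Q\<^esub>" using h by (auto simp: invariants_def)
  have "int p dvd pot z (x \<otimes> h \<otimes> inv x \<otimes> g) - pot z g" if g: "g \<in> carrier F" for g
  proof -
    define g' where "g' = inv x \<otimes> g"
    have g': "g' \<in> carrier F" "x \<otimes> g' = g" using x g by (simp_all add: g'_def flip: G.m_assoc)
    \<comment> \<open>\<open>h\<close> is trivial in \<open>Q\<close>, so the step by
      \<open>x\<close> adds the same from \<open>h \<otimes> g'\<close> as from \<open>g'\<close>,
      and the periodicity of \<open>h\<close> passes to its conjugate.\<close>
    have "pot z (x \<otimes> (h \<otimes> g')) - pot z (h \<otimes> g') = pot z (x \<otimes> g') - pot z g'"
      using x hF g' by (intro pot_increment_cong) auto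
    then have "pot z (x \<otimes> (h \<otimes> g')) - pot z g = pot z (h \<otimes> g') - pot z g'" using g' by simp
    moreover have "x \<otimes> h \<otimes> inv x \<otimes> g = x \<otimes> (h \<otimes> g')" using x hF g by (simp add: g'_def G.m_assoc)
    ultimately show ?thesis using h g' by (simp add: invariants_def)
  qed
  then show "x \<otimes> h \<otimes> inv x \<in> invariants z" using x hF by (simp add: invariants_def)
qed

text \<open>The increments of the potential under \<open>x\<close> depend only on the vertex, so
  \<open>\<pi> x\<close> and one residue for each vertex of \<open>Q\<close> determine the coset of
  \<open>x\<close>.\<close>

lemma finite_rcosets_invariants: "finite (rcosets (invariants z))"
proof (rule G.finite_rcosets_if)
  define f where "f x = (\<pi> x, restrict (\<lambda>v. (pot z (x \<otimes> lift v) - pot z (lift v)) mod int p) (carrier Q))" for x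
  show "subgroup (invariants z) F" using invariants_normal by (rule normal_imp_subgroup)
  have "f ` carrier F \<subseteq> carrier Q \<times> (carrier Q \<rightarrow>\<^sub>E {0..<int p})"
    using prime_gt_0_nat[OF prime_p] by (auto simp: f_def)
  then show "finite (f ` carrier F)"
    by (rule finite_subset) (use finite_Q in \<open>auto intro!: finite_PiE\<close>)
  fix x y assume xy: "x \<in> carrier F" "y \<in> carrier F" "f x = f y"
  have \<pi>: "\<pi> x = \<pi> y" using xy by (simp add: f_def)
  have "int p dvd pot z (x \<otimes> inv y \<otimes> g) - pot z g" if g: "g \<in> carrier F" for g
  proof -
    define g' where "g' = inv y \<otimes> g"
    have g': "g' \<in> carrier F" "y \<otimes> g' = g" using xy g by (simp_all add: g'_def flip: G.m_assoc)
    define v where "v = \<pi> g'"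
    have v: "v \<in> carrier Q" using g' by (simp add: v_def)
    have l: "pot z (w \<otimes> g') - pot z g' = pot z (w \<otimes> lift v) - pot z (lift v)" if "w \<in> carrier F" for w
      using that g' lift[OF v] by (intro pot_increment_cong) (auto simp: v_def)
    have "snd (f x) v = snd (f y) v" using xy by simp
    then have "(pot z (x \<otimes> lift v) - pot z (lift v)) mod int p = (pot z (y \<otimes> lift v) - pot z (lift v)) mod int p"
      using v by (simp add: f_def)
    then have "int p dvd (pot z (x \<otimes> g') - pot z g') - (pot z (y \<otimes> g') - pot z g')"
      unfolding l[OF xy(1)] l[OF xy(2)] by (simp add: mod_eq_dvd_iff)
    then show ?thesis using g' xy g by (simp add: g'_def G.m_assoc)
  qed
  then show "x \<otimes> inv y \<in> invariants z" using xy \<pi> by (simp add: invariants_def)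
qed

lemma relators_invariant: "z \<in> cocycles \<Longrightarrow> relator ` I \<subseteq> invariants z"
  using relator_closed hom_relator by (auto simp: invariants_def cocycles_def)

end

subsection \<open>The Tarski number\<close>

text \<open>Pass to a finite quotient in which lifts of \<open>A\<close> and \<open>B\<close> stay
  distinct and \<open>a\<close> has long cycles, and apply \<open>expanding\<close> with the coset
  map of \<open>K\<close> as \<open>\<theta>\<close>.\<close>

lemma (in group) profinite_quotient_expanding:
  fixes n :: "nat \<Rightarrow> nat"
  assumes p: "prime p" and abc: "distinct [a, b, c]" and X: "free_basis G {a, b, c}"
    and r: "\<And>i. i \<in> I \<Longrightarrow> r i \<in> derived G (carrier G)"
    and weights: "\<And>A. A \<subseteq> I \<Longrightarrow> finite A \<Longrightarrow> (\<Sum>i\<in>A. 1 / real (p ^ n i)) \<le> 1 / 2"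
    and K_def: "K = profinite_kernel G ((\<lambda>i. r i [^] (p ^ n i)) ` I)"
    and A: "A \<subseteq> carrier (G Mod K)" "finite A" and B: "B \<subseteq> carrier (G Mod K)" "finite B"
  shows "card A + card B \<le>
    card (({K, K #> a} <#>\<^bsub>G Mod K\<^esub> A) \<union> ({K, K #> b, K #> c} <#>\<^bsub>G Mod K\<^esub> B))"
proof -
  define R where "R = (\<lambda>i. r i [^] (p ^ n i)) ` I"
  have XG: "{a, b, c} \<subseteq> carrier G" "generate G {a, b, c} = carrier G" using X by (auto simp: free_basis_def)
  have rG: "r i \<in> carrier G" if "i \<in> I" for i
    using r[OF that] derived_in_carrier[of "carrier G"] by auto
  have RG: "R \<subseteq> carrier G" using rG by (auto simp: R_def)
  have RD: "R \<subseteq> derived G (carrier G)"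
  proof
    fix x assume "x \<in> R"
    then obtain i where i: "i \<in> I" "x = r i [^] (p ^ n i)" by (auto simp: R_def)
    then have "r i [^] int (p ^ n i) \<in> derived G (carrier G)"
      by (intro subgroup_int_pow_closed derived_is_subgroup r) auto
    then show "x \<in> derived G (carrier G)" using i(2) by (simp only: int_pow_int)
  qed
  have KR: "K = profinite_kernel G R" by (simp add: K_def R_def)
  interpret K: normal K G unfolding KR by (rule profinite_kernel_normal[OF RG])
  have "\<exists>x. x \<in> carrier G \<and> K #> x = y" if "y \<in> carrier (G Mod K)" for y
    using that by (auto simp: carrier_FactGroup)
  then obtain \<rho> where \<rho>: "\<And>y. y \<in> carrier (G Mod K) \<Longrightarrow> \<rho> y \<in> carrier G \<and> K #> \<rho> y = y" by metis
  have inj: "inj_on \<rho> (carrier (G Mod K))" using \<rho> by (metis inj_onI)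
  define A' B' where "A' = \<rho> ` A" and "B' = \<rho> ` B"
  have AB': "A' \<subseteq> carrier G" "B' \<subseteq> carrier G" "finite A'" "finite B'" using A B \<rho> by (auto simp: A'_def B'_def)
  have cA: "card A' = card A" "card B' = card B"
    unfolding A'_def B'_def using inj A B by (auto intro!: card_image intro: inj_on_subset)
  \<comment> \<open>A normal subgroup that avoids these quotients of distinct lifts separates all
    points of \<open>A'\<close> and \<open>B'\<close>.\<close>
  define D where "D = (\<lambda>(x, y). x \<otimes> inv y) ` ((A' \<union> B') \<times> (A' \<union> B') - Id)"
  have finD: "finite D" unfolding D_def using AB' by (intro finite_imageI finite_Diff) simp
  have DK: "d \<notin> K" if dD: "d \<in> D" for d
  proof
    assume d: "d \<in> K"
    obtain x y where xy: "x \<in> A' \<union> B'" "y \<in> A' \<union> B'" "x \<noteq> y" "d = x \<otimes> inv y" using dD by (auto simp: D_def)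
    then have "K #> x = K #> y" using d rcos_eq_iff[OF K.subgroup_axioms, of x y] AB' by auto
    moreover have "\<rho> (K #> x) = x" "\<rho> (K #> y) = y" using xy(1,2) A B \<rho> by (auto simp: A'_def B'_def)
    ultimately show False using xy(3) by metis
  qed
  obtain \<chi> :: "'a \<Rightarrow> int" where \<chi>: "\<And>x y. x \<in> carrier G \<Longrightarrow> y \<in> carrier G \<Longrightarrow> \<chi> (x \<otimes> y) = \<chi> x + \<chi> y" "\<chi> a = 1"
    by (rule exists_exponent_sum[OF X insertI1]) (rule that)
  \<comment> \<open>The least value with \<open>card A < m\<close>, as \<open>expanding\<close>
    requires.\<close>
  define m where "m = Suc (card A)"
  define N0 where "N0 = {x \<in> carrier G. int m dvd \<chi> x}"
  have N0: "N0 \<lhd> G" "finite (rcosets N0)" "R \<subseteq> N0"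
  proof -
    have m: "m > 0" by (simp add: m_def)
    show "N0 \<lhd> G" unfolding N0_def by (rule derived_finite_index_kernel(1)[OF _ m]) (rule \<chi>(1))
    show "finite (rcosets N0)" unfolding N0_def by (rule derived_finite_index_kernel(2)[OF _ m]) (rule \<chi>(1))
    have "derived G (carrier G) \<subseteq> N0"
      unfolding N0_def by (rule derived_finite_index_kernel(3)[OF _ m]) (rule \<chi>(1))
    then show "R \<subseteq> N0" using RD by blast
  qed
  obtain H where H: "H \<lhd> G" "finite (rcosets H)" "R \<subseteq> H" "H \<subseteq> N0" "H \<inter> D = {}"
    by (rule finite_index_separation[OF N0 finD]) (use DK in \<open>auto simp: KR\<close>)
  interpret H: normal H G by (rule H(1))
  obtain \<Phi> :: "('a \<Rightarrow> 'a \<Rightarrow> int) \<Rightarrow> 'a \<Rightarrow> int" where \<Phi>: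
    "\<And>y g s. g \<in> carrier G \<Longrightarrow> s \<in> {a, b, c} \<Longrightarrow> \<Phi> y (s \<otimes> g) = \<Phi> y g + y g s"
    "\<And>y y' k g. \<Phi> (\<lambda>g s. y g s + k * y' g s) g = \<Phi> y g + k * \<Phi> y' g"
    by (rule potential_exists[OF X]) (rule that)
  interpret W: weighted_quotient G "G Mod H" "(#>) H" "{a, b, c}" \<Phi> p I r n
  proof (intro weighted_quotient.intro weighted_quotient_axioms.intro H.quotient_hom)
    show "finite (carrier (G Mod H))" using H(2) by (simp add: FactGroup_def)
    show "(#>) H ` carrier G = carrier (G Mod H)" by (simp add: carrier_FactGroup)
    show "(H #> r i) [^]\<^bsub>G Mod H\<^esub> (p ^ n i) = \<one>\<^bsub>G Mod H\<^esub>" if "i \<in> I" for i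
    proof -
      have "r i [^] (p ^ n i) \<in> H" using H(3) that by (auto simp: R_def)
      then show ?thesis using rG[OF that] H.rcos_const by (simp add: H.FactGroup_pow is_group)
    qed
  qed (use XG \<Phi> p rG weights in auto)
  have sep: "x = y" if "x \<in> A' \<union> B'" "y \<in> A' \<union> B'" "H #> x = H #> y" for x y
  proof (rule ccontr)
    assume "x \<noteq> y"
    then have "x \<otimes> inv y \<in> D" using that by (force simp: D_def)
    moreover have "x \<otimes> inv y \<in> H" using rcos_eq_iff[OF H.subgroup_axioms, of x y] that AB' by auto
    ultimately show False using H(5) by blast
  qed
  have \<chi>H: "\<chi> x mod int m = \<chi> y mod int m" if "x \<in> carrier G" "y \<in> carrier G" "H #> x = H #> y" for x y
  proof -
    have "x \<otimes> inv y \<in> N0" using rcos_eq_iff[OF H.subgroup_axioms that(1,2)] that(3) H(4) by blast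
    moreover have "\<chi> x = \<chi> (x \<otimes> inv y) + \<chi> y" using \<chi>(1)[of "x \<otimes> inv y" y] that by (simp add: m_assoc)
    ultimately show ?thesis by (simp add: N0_def mod_eq_dvd_iff)
  qed
  \<comment> \<open>Independent of the lift because \<open>H \<subseteq> N0\<close>; multiplication
    by \<open>a\<close> raises it by one modulo \<open>m\<close> because
    \<open>\<chi> a = 1\<close>.\<close>
  define \<kappa> where "\<kappa> v = nat (\<chi> (W.lift v) mod int m)" for v
  have "card A' + card B' \<le> card ((#>) K ` (A' \<union> (\<otimes>) a ` A' \<union> (B' \<union> (\<otimes>) b ` B' \<union> (\<otimes>) c ` B')))"
  proof (rule W.expanding[where \<kappa> = \<kappa> and m = m])
    fix v assume v: "v \<in> carrier (G Mod H)"
    show "\<kappa> v < m" by (simp add: \<kappa>_def m_def nat_less_iff)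
    have av: "(H #> a) \<otimes>\<^bsub>G Mod H\<^esub> v \<in> carrier (G Mod H)" using v XG by (intro W.H.m_closed W.hom_closed) auto
    have lv: "W.lift v \<in> carrier G" "H #> W.lift v = v" using W.lift[OF v] by auto
    have "\<chi> (W.lift ((H #> a) \<otimes>\<^bsub>G Mod H\<^esub> v)) mod int m = \<chi> (a \<otimes> W.lift v) mod int m"
    proof (rule \<chi>H)
      show "H #> W.lift ((H #> a) \<otimes>\<^bsub>G Mod H\<^esub> v) = H #> (a \<otimes> W.lift v)"
        using W.lift(2)[OF av] lv XG H.rcos_sum[of a "W.lift v"] by auto
    qed (use W.lift(1)[OF av] lv XG in auto)
    also have "\<dots> = (\<chi> (W.lift v) mod int m + 1) mod int m" using \<chi> lv XG by (simp add: mod_simps add.commute)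
    finally show "\<kappa> ((H #> a) \<otimes>\<^bsub>G Mod H\<^esub> v) = Suc (\<kappa> v) mod m"
      unfolding \<kappa>_def by (simp add: nat_mod_distrib m_def nat_add_distrib)
  next
    show "inj_on ((#>) H) A'" "inj_on ((#>) H) B'" using sep by (auto intro!: inj_onI)
    show "card A' < m" by (simp add: m_def cA)
    fix z x y g
    assume z: "z \<in> W.cocycles" and xyg: "x \<in> carrier G" "y \<in> carrier G" "g \<in> carrier G" and eq: "K #> x = K #> y"
    \<comment> \<open>\<open>W.invariants z\<close> is one of the subgroups whose intersection is
      \<open>K\<close>.\<close>
    have "K \<subseteq> W.invariants z"
      unfolding KR profinite_kernel_def
      using W.invariants_normal W.finite_rcosets_invariants W.relators_invariant[OF z]
      by (intro Inter_lower) (auto simp: R_def W.relator_def)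
    then have "x \<otimes> inv y \<in> W.invariants z" using rcos_eq_iff[OF K.subgroup_axioms xyg(1,2)] eq by blast
    then have "int p dvd W.pot z (x \<otimes> inv y \<otimes> (y \<otimes> g)) - W.pot z (y \<otimes> g)" using xyg by (auto simp: W.invariants_def)
    moreover have "x \<otimes> inv y \<otimes> (y \<otimes> g) = x \<otimes> g"
      using xyg by (simp add: m_assoc) (simp flip: m_assoc)
    ultimately show "[W.pot z (x \<otimes> g) = W.pot z (y \<otimes> g)] (mod int p)" by (simp add: cong_iff_dvd_diff)
  qed (use abc AB' in auto)
  also have "\<dots> \<le> card (({K, K #> a} <#>\<^bsub>G Mod K\<^esub> A) \<union> ({K, K #> b, K #> c} <#>\<^bsub>G Mod K\<^esub> B))"
  proof (rule card_mono)
    show "finite (({K, K #> a} <#>\<^bsub>G Mod K\<^esub> A) \<union> ({K, K #> b, K #> c} <#>\<^bsub>G Mod K\<^esub> B))"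
      using A B by (simp add: set_mult_def)
    have one: "K #> x \<in> {K, s, t} <#>\<^bsub>G Mod K\<^esub> C" if "x \<in> \<rho> ` C" "C \<subseteq> carrier (G Mod K)" for x s t C
    proof -
      have x: "x \<in> carrier G" "K #> x \<in> C" using that \<rho> by auto
      then have "K <#> (K #> x) = K #> x" using K.rcos_sum[of \<one> x] K.subset by (simp add: coset_mult_one)
      then show ?thesis using x by (force simp: set_mult_def)
    qed
    have mul: "K #> (s \<otimes> x) \<in> S <#>\<^bsub>G Mod K\<^esub> C"
      if "x \<in> \<rho> ` C" "C \<subseteq> carrier (G Mod K)" "s \<in> carrier G" "K #> s \<in> S" for x s S C
    proof -
      have x: "x \<in> carrier G" "K #> x \<in> C" using that \<rho> by auto
      then have "K #> (s \<otimes> x) = (K #> s) <#> (K #> x)" using that K.rcos_sum by simp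
      then show ?thesis using x that(4) by (auto simp: set_mult_def)
    qed
    show "(#>) K ` (A' \<union> (\<otimes>) a ` A' \<union> (B' \<union> (\<otimes>) b ` B' \<union> (\<otimes>) c ` B'))
      \<subseteq> ({K, K #> a} <#>\<^bsub>G Mod K\<^esub> A) \<union> ({K, K #> b, K #> c} <#>\<^bsub>G Mod K\<^esub> B)"
      unfolding image_Un image_image A'_def B'_def
      using one[OF _ A(1), of _ "K #> a" "K #> a"] one[OF _ B(1), of _ "K #> b" "K #> c"]
        mul[OF _ A(1), of _ a "{K, K #> a}"] mul[OF _ B(1), of _ b "{K, K #> b, K #> c}"]
        mul[OF _ B(1), of _ c "{K, K #> b, K #> c}"] XG
      by auto
  qed
  finally show ?thesis unfolding cA .
qed

text \<open>All terms are positive, so no finite part of the sum exceeds \<open>1 / 2\<close>. A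
  negative exponent would give a single term above \<open>1\<close>; hence \<open>nat\<close> does
  not change the exponents. The series starts at \<open>0\<close>, the enumeration at
  \<open>1\<close>, hence the shift.\<close>

lemma weights_of_series:
  fixes n :: "nat \<Rightarrow> int"
  assumes p: "prime (p::nat)" and sm: "summable (\<lambda>i. 1 / real p powi n (Suc i))"
    and le: "(\<Sum>i. 1 / real p powi n (Suc i)) \<le> 1 / 2"
    and A: "A \<subseteq> {1..}" "finite A"
  shows "(\<Sum>i\<in>A. 1 / real (p ^ nat (n i))) \<le> 1 / 2"
proof -
  have p1: "real p > 1" using prime_gt_1_nat[OF p] by simp
  have part: "(\<Sum>i\<in>C. 1 / real p powi n (Suc i)) \<le> 1 / 2" if "finite C" for C
    using sum_le_suminf[OF sm that] le p1 by (force intro: order_trans)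
  have pos: "n i \<ge> 0" if "i \<ge> 1" for i
  proof (rule ccontr)
    assume neg: "\<not> n i \<ge> 0"
    have "1 / real p powi n (Suc (i - 1)) \<le> 1 / 2" using part[of "{i - 1}"] by simp
    moreover have "real p powi n i \<le> 1" using neg p1 by (simp add: power_int_def inverse_le_1_iff power_le_one one_le_power)
    moreover have "real p powi n i > 0" using p1 by simp
    ultimately show False using that by (simp add: field_simps)
  qed
  have "(\<Sum>i\<in>A. 1 / real (p ^ nat (n i))) = (\<Sum>i\<in>A. 1 / real p powi n i)"
    using A pos by (intro sum.cong) (auto simp: power_int_def)
  also have "\<dots> = (\<Sum>i\<in>(\<lambda>i. i - 1) ` A. 1 / real p powi n (Suc i))"
  proof (subst sum.reindex)
    show "inj_on (\<lambda>i. i - 1) A"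
    proof (rule inj_onI)
      fix i j assume ij: "i \<in> A" "j \<in> A" "i - 1 = j - 1"
      then have "i \<ge> 1" "j \<ge> 1" using A by auto
      then show "i = j" using ij by simp
    qed
  qed (use A in \<open>auto intro!: sum.cong\<close>)
  also have "\<dots> \<le> 1 / 2" using A by (intro part) auto
  finally show ?thesis .
qed

theorem theorem2p3:
  fixes p :: nat
    and F :: "('a, 'b) monoid_scheme"
    and a b c :: 'a
    and r :: "nat \<Rightarrow> 'a"
    and n :: "nat \<Rightarrow> int"
  assumes "prime p"
    and "group F"
    and "distinct [a, b, c]"
    and "free_basis F {a, b, c}"
    and "r ` {1..} = derived F (carrier F)"
    and "summable (\<lambda>i. 1 / real p powi n (Suc i))"
    and "(\<Sum>i. 1 / real p powi n (Suc i)) \<le> 1 / 2"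
    and "R = {r i [^]\<^bsub>F\<^esub> (p ^ nat (n i)) | i. i \<ge> 1}"
    and "G = F Mod normal_closure F R"
  shows "admits_paradoxical_decomposition G \<and> tarski_number G = 5"
proof -
  interpret F: group F by fact
  define N where "N = normal_closure F R"
  define K where "K = profinite_kernel F R"
  have RI: "R = (\<lambda>i. r i [^]\<^bsub>F\<^esub> (p ^ nat (n i))) ` {1..}" using assms(8) by auto
  have rd: "r i \<in> derived F (carrier F)" if "i \<in> {1..}" for i using assms(5) that by blast
  have rF: "r i \<in> carrier F" if "i \<in> {1..}" for i
    using rd[OF that] F.derived_in_carrier[of "carrier F"] by auto
  have RF: "R \<subseteq> carrier F" using rF by (auto simp: RI)
  interpret N: normal N F unfolding N_def by (rule F.normal_closure_normal[OF RF])
  interpret K: normal K F unfolding K_def by (rule F.profinite_kernel_normal[OF RF])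
  have RN: "R \<subseteq> N" unfolding N_def by (rule F.normal_closure_normal[OF RF])
  have NK: "N \<subseteq> K" unfolding N_def K_def by (rule F.normal_closure_subset_profinite_kernel)
  have G: "G = F Mod N" using assms(9) by (simp add: N_def)
  interpret G: group G unfolding G by (rule N.factorgroup_is_group)
  interpret \<Gamma>: group "F Mod K" by (rule K.factorgroup_is_group)
  have X: "{a, b, c} \<subseteq> carrier F" using assms(4) by (auto simp: free_basis_def)
  define S where "S = {K, K #>\<^bsub>F\<^esub> a}"
  define T where "T = {K, K #>\<^bsub>F\<^esub> b, K #>\<^bsub>F\<^esub> c}"
  have Kc: "K \<in> carrier (F Mod K)" using \<Gamma>.one_closed by simp
  have ST: "S \<subseteq> carrier (F Mod K)" "T \<subseteq> carrier (F Mod K)"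
    using X Kc by (auto simp: S_def T_def carrier_FactGroup)
  have "\<exists>P Q g h. paradoxical_decomposition (F Mod K) (card S) (card T) P Q g h"
  proof (rule \<Gamma>.paradoxical_decomposition_if_expanding)
    fix A B assume AB: "A \<subseteq> carrier (F Mod K)" "finite A" "B \<subseteq> carrier (F Mod K)" "finite B"
    show "card A + card B \<le> card ((S <#>\<^bsub>F Mod K\<^esub> A) \<union> (T <#>\<^bsub>F Mod K\<^esub> B))"
      unfolding S_def T_def
    proof (rule F.profinite_quotient_expanding[OF assms(1,3,4), where I = "{1..}" and r = r and n = "\<lambda>i. nat (n i)"])
      show "K = profinite_kernel F ((\<lambda>i. r i [^]\<^bsub>F\<^esub> (p ^ nat (n i))) ` {1..})" by (simp add: K_def RI)
    qed (use AB rd weights_of_series[OF assms(1,6,7)] in auto)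
  qed (use ST in \<open>auto simp: S_def T_def\<close>)
  then obtain P Q g h where pdK: "paradoxical_decomposition (F Mod K) (card S) (card T) P Q g h" by blast
  interpret q: group_hom G "F Mod K" "(<#>\<^bsub>F\<^esub>) K"
    unfolding G by (rule F.quotient_of_quotient_hom[OF N.normal_axioms K.normal_axioms NK])
  have "(<#>\<^bsub>F\<^esub>) K ` carrier G = carrier (F Mod K)"
    unfolding G by (rule F.quotient_of_quotient_hom[OF N.normal_axioms K.normal_axioms NK])
  from q.paradoxical_decomposition_pullback[OF this pdK]
  obtain P' Q' g' h' where pd: "paradoxical_decomposition G (card S) (card T) P' Q' g' h'" by blast
  \<comment> \<open>A commutator in \<open>G\<close> lifts to a commutator in \<open>F\<close>,
    which is some \<open>r i\<close>, and a power of \<open>r i\<close> is a relator.\<close>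
  have tors: "\<exists>k>0::nat. (x \<otimes>\<^bsub>G\<^esub> y \<otimes>\<^bsub>G\<^esub> inv\<^bsub>G\<^esub> x \<otimes>\<^bsub>G\<^esub> inv\<^bsub>G\<^esub> y) [^]\<^bsub>G\<^esub> k = \<one>\<^bsub>G\<^esub>"
    if xy: "x \<in> carrier G" "y \<in> carrier G" for x y
  proof -
    obtain u v where uv: "u \<in> carrier F" "v \<in> carrier F" "x = N #>\<^bsub>F\<^esub> u" "y = N #>\<^bsub>F\<^esub> v"
      using xy by (auto simp: G carrier_FactGroup)
    define w where "w = u \<otimes>\<^bsub>F\<^esub> v \<otimes>\<^bsub>F\<^esub> inv\<^bsub>F\<^esub> u \<otimes>\<^bsub>F\<^esub> inv\<^bsub>F\<^esub> v"
    interpret \<nu>: group_hom F G "(#>\<^bsub>F\<^esub>) N" unfolding G by (rule N.quotient_hom)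
    have "w \<in> derived F (carrier F)"
      unfolding derived_def w_def using uv by (intro generate.incl) auto
    then obtain i where i: "i \<in> {1..}" "w = r i" using assms(5) by (metis imageE)
    have "w [^]\<^bsub>F\<^esub> (p ^ nat (n i)) \<in> N" using RN i by (auto simp: RI)
    moreover have wF: "w \<in> carrier F" using uv by (simp add: w_def)
    ultimately have "(N #>\<^bsub>F\<^esub> w) [^]\<^bsub>G\<^esub> (p ^ nat (n i)) = \<one>\<^bsub>G\<^esub>"
      using N.rcos_const[OF F.is_group] by (simp add: G N.FactGroup_pow)
    moreover have "N #>\<^bsub>F\<^esub> w = x \<otimes>\<^bsub>G\<^esub> y \<otimes>\<^bsub>G\<^esub> inv\<^bsub>G\<^esub> x \<otimes>\<^bsub>G\<^esub> inv\<^bsub>G\<^esub> y"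
      using uv by (simp add: w_def \<nu>.hom_mult \<nu>.hom_inv)
    ultimately show ?thesis using prime_gt_0_nat[OF assms(1)] by (intro exI[of _ "p ^ nat (n i)"]) auto
  qed
  \<comment> \<open>Distinctness of the cosets in \<open>S\<close> and \<open>T\<close> is not
    checked directly: the lower bound forces both cardinalities to be maximal.\<close>
  have "card S \<le> 2" "card T \<le> 3" by (simp_all add: S_def T_def card_insert_if)
  then have "card S + card T = 5" using G.paradoxical_decomposition_ge5[OF pd tors] by linarith
  then have "tarski_number G = 5"
    unfolding tarski_number_def
    using pd G.paradoxical_decomposition_ge5[OF _ tors] by (intro Least_equality) (metis, metis)
  moreover have "admits_paradoxical_decomposition G"
    unfolding admits_paradoxical_decomposition_def by (intro exI) (rule pd)
  ultimately show ?thesis by simp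
qed

end
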